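(* Let $p$ be a prime and let $G=\prod_{s=1}^{n}G_s$ be a finite abelian $p$-group of exponent $p^n$, where $n\ge1$ and $G_s$ is a product of $a_s\ge 0$ copies of the cyclic group of order $p^s$ (with $a_n\ge1$). For $1\le r\le n$ put $$b_r=a_r+a_{r+1}+\dots+a_n,\qquad c_r=a_1+2a_2+\dots+(r-1)a_{r-1}.$$ Then for $1\le r\le n$ the coefficient of $\mathbb{Q}(\zeta_{p^r})$ in the Wedderburn decomposition of $\mathbb{Q}[G]$ is a polynomial in $p$; in fact it is equal to $$p^{\,c_r+(r-1)(b_r-1)}\left(\frac{p^{b_r}-1}{p-1}\right).$$
   Context: $\zeta_{k}$ denotes a complex primitive $k$-th root of unity. For each primitive central idempotent $e$ of $\mathbb{Q}[G]$, the component $\mathbb{Q}[G]e$ is a field, the group $Ge=\{ge: g\in G\}$ is cyclic of some order $p^r$ with $0\le r\le n$, and $\mathbb{Q}[G]e\cong\mathbb{Q}(\zeta_{p^r})$. The coefficient of $\mathbb{Q}(\zeta_{p^r})$ in the Wedderburn decomposition of $\mathbb{Q}[G]$ means the number of primitive central idempotents $e$ for which $Ge$ is cyclic of order exactly $p^r$; equivalently, the number of subgroups of $G$ with factor group cyclic of order $p^r$. (In particular for $p=2$ the components labelled $\mathbb{Q}(\zeta_2)$ and $\mathbb{Q}(\zeta_1)$ are counted separately, although both fields are $\mathbb{Q}$.) *)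

theory Defs
  imports "HOL-Algebra.Product_Groups" "HOL-Algebra.Ring" "HOL-Computational_Algebra.Polynomial"
    "HOL-Computational_Algebra.Primes"
begin

text \<open>
  The rational group algebra \<open>\<rat>[G]\<close>: finitely supported functions on the carrier of \<open>G\<close>,
  extended by \<open>0\<close> to the whole type so that equality of functions is equality of elements.
  The function \<open>f\<close> stands for \<open>\<Sum>g. f g \<cdot> g\<close>, and multiplication is convolution.
\<close>

definition rat_group_algebra :: "('a, 'b) monoid_scheme \<Rightarrow> ('a \<Rightarrow> rat) ring" where
  "rat_group_algebra G =
    \<lparr> carrier = {f. finite {x. f x \<noteq> 0} \<and> {x. f x \<noteq> 0} \<subseteq> carrier G},
      monoid.mult = (\<lambda>f g x. if x \<in> carrier G
                       then \<Sum>y\<in>{y. f y \<noteq> 0}. f y * g (inv\<^bsub>G\<^esub> y \<otimes>\<^bsub>G\<^esub> x) else 0),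
      one = (\<lambda>x. if x = \<one>\<^bsub>G\<^esub> then 1 else 0),
      zero = (\<lambda>x. 0),
      add = (\<lambda>f g x. f x + g x) \<rparr>"

definition group_element :: "'a \<Rightarrow> 'a \<Rightarrow> rat" where
  "group_element g = (\<lambda>x. if x = g then 1 else 0)"

definition central_idempotent :: "('r, 'b) ring_scheme \<Rightarrow> 'r \<Rightarrow> bool" where
  "central_idempotent R e \<longleftrightarrow>
     e \<in> carrier R \<and> e \<otimes>\<^bsub>R\<^esub> e = e \<and> (\<forall>x\<in>carrier R. e \<otimes>\<^bsub>R\<^esub> x = x \<otimes>\<^bsub>R\<^esub> e)"

definition primitive_central_idempotent :: "('r, 'b) ring_scheme \<Rightarrow> 'r \<Rightarrow> bool" where
  "primitive_central_idempotent R e \<longleftrightarrow>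
     central_idempotent R e \<and> e \<noteq> \<zero>\<^bsub>R\<^esub> \<and>
     \<not> (\<exists>e1 e2. central_idempotent R e1 \<and> central_idempotent R e2 \<and>
            e1 \<noteq> \<zero>\<^bsub>R\<^esub> \<and> e2 \<noteq> \<zero>\<^bsub>R\<^esub> \<and> e1 \<otimes>\<^bsub>R\<^esub> e2 = \<zero>\<^bsub>R\<^esub> \<and> e = e1 \<oplus>\<^bsub>R\<^esub> e2)"

text \<open>
  The group \<open>Ge = {ge : g \<in> G}\<close> inside \<open>\<rat>[G]e\<close>; its identity is \<open>e\<close>, not the one of \<open>\<rat>[G]\<close>.
\<close>

definition component_group :: "('a, 'b) monoid_scheme \<Rightarrow> ('a \<Rightarrow> rat) \<Rightarrow> ('a \<Rightarrow> rat) monoid" where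
  "component_group G e =
    \<lparr> carrier = (\<lambda>g. group_element g \<otimes>\<^bsub>rat_group_algebra G\<^esub> e) ` carrier G,
      monoid.mult = monoid.mult (rat_group_algebra G),
      one = e \<rparr>"

text \<open>
  The coefficient of \<open>\<rat>(\<zeta>\<^sub>m)\<close> in the Wedderburn decomposition of \<open>\<rat>[G]\<close>, for a finite abelian
  group \<open>G\<close>. Components are labelled by the order of \<open>Ge\<close>, so that \<open>\<rat>(\<zeta>\<^sub>1)\<close> and \<open>\<rat>(\<zeta>\<^sub>2)\<close> are
  counted separately although both fields are \<open>\<rat>\<close>.
\<close>

definition wedderburn_coeff :: "('a, 'b) monoid_scheme \<Rightarrow> nat \<Rightarrow> nat" where
  "wedderburn_coeff G m =
     card {e. primitive_central_idempotent (rat_group_algebra G) e \<and>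
              cyclic_group (component_group G e) \<and> Coset.order (component_group G e) = m}"

text \<open>
  \<open>\<Prod>\<^bsub>s=1..n\<^esub> G\<^sub>s\<close> with \<open>G\<^sub>s\<close> a product of \<open>a s\<close> copies of the cyclic group of order \<open>p ^ s\<close>.
\<close>

definition abelian_p_group :: "nat \<Rightarrow> nat \<Rightarrow> (nat \<Rightarrow> nat) \<Rightarrow> (nat \<Rightarrow> nat \<Rightarrow> int) monoid" where
  "abelian_p_group p n a =
     product_group {1..n} (\<lambda>s. product_group {..<a s} (\<lambda>j. integer_mod_group (p ^ s)))"

definition b_exp :: "nat \<Rightarrow> (nat \<Rightarrow> nat) \<Rightarrow> nat \<Rightarrow> nat" where
  "b_exp n a r = (\<Sum>s=r..n. a s)"

definition c_exp :: "(nat \<Rightarrow> nat) \<Rightarrow> nat \<Rightarrow> nat" where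
  "c_exp a r = (\<Sum>s=1..<r. s * a s)"

end

theory Submission
  imports Defs "HOL-Computational_Algebra.Polynomial_Factorial"
begin

text \<open>
  Let \<open>q = p ^ (r - 1)\<close>. A surjective character \<open>\<chi> : G \<rightarrow> \<int>/p ^ r\<close> has an idempotent
  \<open>e\<^sub>\<chi> = K\<^sup>- - L\<^sup>-\<close>, the difference of the averages over \<open>K = ker \<chi>\<close> and over the preimage \<open>L\<close> of
  the subgroup of order \<open>p\<close>. Its coefficients are the values of a Ramanujan sum divided by \<open>|G|\<close>.
  Because the cyclotomic polynomial of order \<open>p ^ r\<close> is irreducible (Eisenstein at \<open>x + 1\<close>), every
  idempotent \<open>f\<close> satisfies \<open>f e\<^sub>\<chi> = 0\<close> or \<open>f e\<^sub>\<chi> = e\<^sub>\<chi>\<close>, so \<open>e\<^sub>\<chi>\<close> is primitive and \<open>G e\<^sub>\<chi>\<close> is cyclic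
  of order \<open>p ^ r\<close>. Conversely, if \<open>f\<close> is primitive and \<open>G f\<close> is cyclic of order \<open>p ^ r\<close>, then
  \<open>g \<mapsto> g f\<close> yields such a \<open>\<chi>\<close>, with \<open>K\<^sup>- f = f\<close> and \<open>L\<^sup>- f = 0\<close>, whence \<open>f e\<^sub>\<chi> = f\<close> and \<open>f = e\<^sub>\<chi>\<close>.

  Two characters have the same idempotent iff they differ by a unit of \<open>\<int>/p ^ r\<close>, and the
  non-surjective characters are those with values in \<open>p \<int>/p ^ r\<close>. Hence the coefficient times
  \<open>p ^ r - p ^ (r - 1)\<close> is \<open>|Hom(G, \<int>/p ^ r)| - |Hom(G, \<int>/p ^ (r - 1))|\<close>, and
  \<open>|Hom(G, \<int>/p ^ k)|\<close> is the product of the \<open>p ^ (min s k * a s)\<close>.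
\<close>

section \<open>Irreducibility of cyclotomic polynomials of prime power order\<close>

text \<open>In \<open>f = A * B\<close> the prime divides exactly one constant term, say that of
  \<open>A\<close>. At the first coefficient of \<open>A\<close> prime to \<open>p\<close>, say of
  index \<open>k\<close>, the coefficient of \<open>f\<close> is also prime to \<open>p\<close>, so
  \<open>k\<close> is at least \<open>degree f\<close>. Hence \<open>B\<close> is constant, and
  content 1 makes it a unit of \<int>[x].\<close>

lemma eisenstein_irreducible:
  fixes f :: "int poly" and p :: int
  assumes p: "prime p" and deg: "degree f > 0" and cont: "content f = 1"
    and lead: "\<not> p dvd lead_coeff f" and low: "\<And>i. i < degree f \<Longrightarrow> p dvd coeff f i"
    and const: "\<not> p ^ 2 dvd coeff f 0"
  shows "irreducible f"
proof -
  have unit: "B dvd 1" if f: "f = A * B" and A0: "p dvd coeff A 0" for A B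
  proof -
    have f0: "f \<noteq> 0" using deg by auto
    then have AB: "A \<noteq> 0" "B \<noteq> 0" using f by auto
    have "\<not> p dvd coeff B 0"
      using const A0 by (auto simp: f coeff_mult power2_eq_square mult_dvd_mono)
    moreover define k where "k = (LEAST k. \<not> p dvd coeff A k)"
    have "\<not> p dvd coeff A (degree A)"
      using lead by (auto simp: f lead_coeff_mult)
    then have k: "\<not> p dvd coeff A k" and "k \<le> degree A" and least: "\<And>i. i < k \<Longrightarrow> p dvd coeff A i"
      unfolding k_def by (rule LeastI) (rule Least_le, fact, use not_less_Least in blast)
    have "coeff f k = (\<Sum>i<k. coeff A i * coeff B (k - i)) + coeff A k * coeff B 0"
      by (simp add: f coeff_mult flip: lessThan_Suc_atMost)
    moreover have "p dvd (\<Sum>i<k. coeff A i * coeff B (k - i))"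
      using least by (intro dvd_sum) auto
    ultimately have "\<not> p dvd coeff f k"
      using k p by (simp add: dvd_add_right_iff prime_dvd_mult_iff)
    then have "degree f \<le> degree A"
      using low \<open>k \<le> degree A\<close> by (meson le_trans not_le)
    then have "degree B = 0"
      using AB by (simp add: f degree_mult_eq)
    then obtain b where b: "B = [:b:]" by (rule degree_eq_zeroE)
    then have "b dvd content f"
      by (simp add: f flip: const_poly_dvd_iff_dvd_content)
    then show ?thesis using cont by (simp add: b is_unit_const_poly_iff)
  qed
  show ?thesis
  proof (rule irreducibleI)
    show "f \<noteq> 0" "\<not> f dvd 1"
      using deg by (auto simp: is_unit_poly_iff)
  next
    fix A B assume f: "f = A * B"
    have "p dvd coeff A 0 * coeff B 0"
      using low[of 0] deg by (simp add: f coeff_mult)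
    then show "A dvd 1 \<or> B dvd 1"
      using unit[of A B] unit[of B A] f p by (auto simp: prime_dvd_mult_iff mult.commute)
  qed
qed

text \<open>All binomial coefficients strictly between the two ends of row \<open>p\<close> are
  divisible by \<open>p\<close>.\<close>

lemma prime_dvd_binomial_diff:
  fixes a b :: "'a :: comm_ring_1"
  assumes "prime p"
  shows "of_nat p dvd (a + b) ^ p - (a ^ p + b ^ p)"
proof -
  have p: "p > 0" using assms prime_gt_0_nat by blast
  have "(a + b) ^ p = (\<Sum>k\<in>{0..p}. of_nat (p choose k) * a ^ k * b ^ (p - k))"
    by (simp add: binomial_ring atLeast0AtMost)
  also have "{0..p} = insert 0 (insert p {0<..<p})" using p by auto
  also have "(\<Sum>k\<in>\<dots>. of_nat (p choose k) * a ^ k * b ^ (p - k)) =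
      a ^ p + b ^ p + (\<Sum>k\<in>{0<..<p}. of_nat (p choose k) * a ^ k * b ^ (p - k))"
    using p by simp
  finally have "(a + b) ^ p - (a ^ p + b ^ p) = (\<Sum>k\<in>{0<..<p}. of_nat (p choose k) * a ^ k * b ^ (p - k))"
    by simp
  also have "of_nat p dvd \<dots>"
  proof (intro dvd_sum dvd_mult2)
    fix k assume "k \<in> {0<..<p}"
    then have "p dvd (p choose k)" using assms by (intro dvd_choose_prime) auto
    then show "(of_nat p :: 'a) dvd of_nat (p choose k)" by (elim dvdE) simp
  qed
  finally show ?thesis .
qed

text \<open>The case \<open>k = 1\<close> is iterated: elements congruent modulo \<open>p\<close>
  have congruent \<open>p\<close>-th powers, because \<open>u - v\<close> divides
  \<open>u ^ p - v ^ p\<close>.\<close>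

lemma prime_dvd_add_power_diff:
  fixes a b :: "'a :: comm_ring_1"
  assumes "prime p"
  shows "of_nat p dvd (a + b) ^ (p ^ k) - (a ^ (p ^ k) + b ^ (p ^ k))"
proof (induction k)
  case (Suc k)
  let ?u = "(a + b) ^ (p ^ k)" and ?v = "a ^ (p ^ k) + b ^ (p ^ k)"
  have "?u - ?v dvd ?u ^ p - ?v ^ p"
    by (simp add: power_diff_sumr2)
  then have "of_nat p dvd ?u ^ p - ?v ^ p" using Suc dvd_trans by blast
  moreover have "of_nat p dvd ?v ^ p - ((a ^ (p ^ k)) ^ p + (b ^ (p ^ k)) ^ p)"
    by (rule prime_dvd_binomial_diff[OF assms])
  ultimately have "of_nat p dvd (?u ^ p - ?v ^ p) + (?v ^ p - ((a ^ (p ^ k)) ^ p + (b ^ (p ^ k)) ^ p))"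
    by (rule dvd_add)
  then show ?case by (simp only: power_Suc2 power_mult add_diff_add add_diff_cancel diff_add_cancel
        add_diff_eq)
qed auto

text \<open>The cyclotomic polynomial of order \<open>p ^ r\<close> is \<open>prime_cyclotomic p (p ^ (r - 1))\<close>.\<close>

definition prime_cyclotomic :: "nat \<Rightarrow> nat \<Rightarrow> int poly" where
  "prime_cyclotomic p q = (\<Sum>i<p. monom 1 (i * q))"

lemma prime_cyclotomic_mult: "(monom 1 q - 1) * prime_cyclotomic p q = monom 1 (p * q) - 1"
proof -
  have "monom (1 :: int) (p * q) - 1 = monom 1 q ^ p - 1"
    by (simp add: monom_power mult.commute)
  also have "\<dots> = (monom 1 q - 1) * (\<Sum>i<p. monom 1 q ^ i)"
    by (rule power_diff_1_eq)
  finally show ?thesis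
    by (simp add: prime_cyclotomic_def monom_power mult.commute)
qed

text \<open>Substituting \<open>x + 1\<close> for \<open>x\<close> gives a polynomial
  \<open>C\<close> to which Eisenstein's criterion applies; irreducibility is then carried back by
  the inverse substitution.\<close>

lemma irreducible_prime_cyclotomic:
  assumes p: "prime p"
  shows "irreducible (prime_cyclotomic p (p ^ k))"
proof -
  define q where "q = p ^ k"
  define y where "y = [:1, 1 :: int:]"
  define C where "C = pcompose (prime_cyclotomic p q) y"
  have p0: "p > 1" using p prime_gt_1_nat by blast
  have q0: "q > 0" using p0 by (simp add: q_def)
  have comp: "pcompose (monom 1 n) y = y ^ n" for n
    by (induction n) (simp_all add: monom_Suc pcompose_pCons y_def monom_0 pcompose_1 flip: one_pCons)
  have yx: "y = monom 1 1 + 1"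
    by (simp add: y_def monom_Suc monom_0 one_pCons)
  have C: "(y ^ q - 1) * C = y ^ (p * q) - 1"
    using arg_cong[OF prime_cyclotomic_mult[of q p], of "\<lambda>f. pcompose f y"]
    by (simp add: C_def pcompose_mult pcompose_diff pcompose_1 comp)
  \<comment> \<open>The constant term of \<open>C\<close> is the value of the cyclotomic polynomial
    at 1, a sum of \<open>p\<close> ones.\<close>
  have C0: "coeff C 0 = int p"
    by (simp add: C_def y_def prime_cyclotomic_def poly_pcompose poly_sum poly_monom flip: poly_0_coeff_0)
  have yn: "degree (y ^ n - 1) = n" "lead_coeff (y ^ n - 1) = 1" if "n > 0" for n
  proof -
    have "degree (y ^ n) = n"
      by (simp add: y_def degree_power_eq)
    moreover have "lead_coeff (y ^ n) = lead_coeff y ^ n"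
      by (rule lead_coeff_power)
    ultimately have y: "degree (y ^ n) = n" "coeff (y ^ n) n = 1"
      by (simp_all add: y_def)
    then show *: "degree (y ^ n - 1) = n"
      using that y degree_add_eq_left[of "- 1" "y ^ n"] by simp
    show "lead_coeff (y ^ n - 1) = 1"
      using that y unfolding * by simp
  qed
  have Cn0: "C \<noteq> 0" using C0 p0 by auto
  have yq0: "y ^ q - 1 \<noteq> 0" using yn[OF q0] by fastforce
  have dC: "degree C + q = p * q"
    using arg_cong[OF C, of degree] Cn0 yq0 yn q0 p0 by (simp add: degree_mult_eq)
  have lC: "lead_coeff C = 1"
    using arg_cong[OF C, of lead_coeff] yn q0 p0 by (simp add: lead_coeff_mult)
  have mod: "[:int p:] dvd y ^ (p ^ j) - (monom 1 (p ^ j) + 1)" for j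
    using prime_dvd_add_power_diff[OF p, of "monom 1 1" "1 :: int poly" j]
    by (simp add: yx monom_power of_nat_poly)
  \<comment> \<open>Modulo \<open>p\<close> the relation \<open>C\<close> reads
    \<open>x ^ q * C = x ^ (p * q)\<close>, so every coefficient of \<open>C\<close> below the
    leading one is divisible by \<open>p\<close>.\<close>
  have "[:int p:] dvd (y ^ (p * q) - (monom 1 (p * q) + 1)) - (y ^ q - (monom 1 q + 1)) * C"
    using dvd_diff[OF mod[of "Suc k"] dvd_mult2[OF mod[of k]]] by (simp add: q_def)
  also have "\<dots> = monom 1 q * C - monom 1 (p * q)"
    using C by (simp add: algebra_simps)
  finally have dvd: "int p dvd coeff (monom 1 q * C - monom 1 (p * q)) i" for i
    by (simp add: const_poly_dvd_iff)
  have "irreducible C"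
  proof (rule eisenstein_irreducible)
    show "prime (int p)" using p by simp
    show "degree C > 0" using dC p0 q0 by (cases "degree C = 0") auto
    show "content C = 1"
      by (metis lC content_dvd_coeff dvd_refl is_unit_normalize normalize_content)
    show "\<not> int p dvd lead_coeff C" using lC p0 by simp
    show "int p dvd coeff C i" if "i < degree C" for i
      using dvd[of "q + i"] that dC by (simp add: coeff_monom_mult)
    show "\<not> (int p)\<^sup>2 dvd coeff C 0"
    proof
      assume "(int p)\<^sup>2 dvd coeff C 0"
      then have "int p * int p dvd int p * 1" by (simp add: C0 power2_eq_square)
      then show False using p0 by (subst (asm) dvd_times_left_cancel_iff) auto
    qed
  qed
  show ?thesis
  proof (rule irreducibleI)
    show "prime_cyclotomic p (p ^ k) \<noteq> 0" using Cn0 by (auto simp: C_def q_def)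
    show "\<not> prime_cyclotomic p (p ^ k) dvd 1"
    proof
      assume "prime_cyclotomic p (p ^ k) dvd 1"
      then have "C dvd 1" by (auto simp: C_def q_def elim!: dvdE) (metis dvd_def pcompose_1 pcompose_mult)
      then show False using \<open>irreducible C\<close> irreducible_not_unit by blast
    qed
    fix a b assume ab: "prime_cyclotomic p (p ^ k) = a * b"
    then have "C = pcompose a y * pcompose b y" by (simp add: C_def q_def pcompose_mult)
    then have "pcompose a y dvd 1 \<or> pcompose b y dvd 1"
      using \<open>irreducible C\<close> by (simp add: irreducibleD)
    \<comment> \<open>Composition with \<open>x - 1\<close> undoes the shift, so units pull back to
      units.\<close>
    moreover have "c dvd 1" if "pcompose c y dvd 1" for c
    proof -
      have "pcompose (pcompose c y) [:-1, 1:] = c"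
        by (simp add: y_def pcompose_pCons flip: pcompose_assoc)
      then show ?thesis using that
        by (metis dvd_def pcompose_1 pcompose_mult)
    qed
    ultimately show "a dvd 1 \<or> b dvd 1" by blast
  qed
qed

section \<open>The group algebra of a finite abelian group\<close>

locale finite_comm_group = comm_group G for G (structure) +
  assumes finite_carrier [simp]: "finite (carrier G)"
begin

abbreviation R where "R \<equiv> rat_group_algebra G"

lemma mem_carrier_R: "f \<in> carrier R \<longleftrightarrow> (\<forall>x. x \<notin> carrier G \<longrightarrow> f x = 0)"
  by (auto simp: rat_group_algebra_def intro: finite_subset[OF _ finite_carrier])

lemma one_R: "\<one>\<^bsub>R\<^esub> = group_element \<one>"
  and zero_R: "\<zero>\<^bsub>R\<^esub> = (\<lambda>x. 0)"
  and add_R: "f \<oplus>\<^bsub>R\<^esub> g = (\<lambda>x. f x + g x)"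
  by (simp_all add: rat_group_algebra_def group_element_def)

text \<open>Summing over the whole carrier instead of the support gives an index set that
  translations and inversion permute.\<close>

lemma mult_R:
  assumes "f \<in> carrier R"
  shows "f \<otimes>\<^bsub>R\<^esub> g = (\<lambda>x. if x \<in> carrier G then \<Sum>y\<in>carrier G. f y * g (inv y \<otimes> x) else 0)"
proof -
  have "(\<Sum>y\<in>{y. f y \<noteq> 0}. f y * g (inv y \<otimes> x)) = (\<Sum>y\<in>carrier G. f y * g (inv y \<otimes> x))" for x
    using assms by (intro sum.mono_neutral_left) (auto simp: mem_carrier_R)
  then show ?thesis
    unfolding rat_group_algebra_def by (intro ext) simp
qed

lemma sum_translate:
  assumes "a \<in> carrier G"
  shows "(\<Sum>y\<in>carrier G. F (a \<otimes> y)) = (\<Sum>y\<in>carrier G. F y)"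
  by (rule sum.reindex_bij_witness[of _ "\<lambda>y. inv a \<otimes> y" "\<lambda>y. a \<otimes> y"])
     (use assms in \<open>auto simp flip: m_assoc\<close>)

lemma sum_inv: "(\<Sum>y\<in>carrier G. F (inv y)) = (\<Sum>y\<in>carrier G. F y)"
  by (rule sum.reindex_bij_witness[of _ "\<lambda>y. inv y" "\<lambda>y. inv y"]) auto

lemma mult_R_closed: "f \<in> carrier R \<Longrightarrow> f \<otimes>\<^bsub>R\<^esub> g \<in> carrier R"
  by (simp add: mult_R mem_carrier_R)

lemma group_element_closed [simp]: "g \<in> carrier G \<Longrightarrow> group_element g \<in> carrier R"
  by (auto simp: mem_carrier_R group_element_def)

lemma group_element_mult:
  assumes "g \<in> carrier G"
  shows "group_element g \<otimes>\<^bsub>R\<^esub> f = (\<lambda>x. if x \<in> carrier G then f (inv g \<otimes> x) else 0)"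
proof -
  have "(\<Sum>y\<in>carrier G. group_element g y * f (inv y \<otimes> x)) = f (inv g \<otimes> x)" for x
    using assms by (simp add: group_element_def if_distrib[of "\<lambda>u. u * _"] cong: if_cong)
  then show ?thesis using assms by (intro ext) (simp add: mult_R)
qed

lemma group_element_mult_group_element:
  assumes "g \<in> carrier G" "h \<in> carrier G"
  shows "group_element g \<otimes>\<^bsub>R\<^esub> group_element h = group_element (g \<otimes> h)"
proof -
  have "inv g \<otimes> x = h \<longleftrightarrow> x = g \<otimes> h" if "x \<in> carrier G" for x
    using assms that inv_solve_left'[of x g h] by (metis inv_closed inv_solve_left m_closed)
  then show ?thesis
    unfolding group_element_mult[OF assms(1)] using assms by (auto simp: group_element_def fun_eq_iff)
qed

sublocale R: cring R
proof (rule cringI)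
  show "abelian_group R"
  proof (rule abelian_groupI)
    fix f assume "f \<in> carrier R"
    then show "\<exists>g\<in>carrier R. g \<oplus>\<^bsub>R\<^esub> f = \<zero>\<^bsub>R\<^esub>"
      by (intro bexI[of _ "\<lambda>x. - f x"]) (auto simp: mem_carrier_R add_R zero_R)
  qed (auto simp: mem_carrier_R add_R zero_R add_ac)
  show "Group.comm_monoid R"
  proof (rule comm_monoidI)
    fix f g h assume R: "f \<in> carrier R" "g \<in> carrier R" "h \<in> carrier R"
    show "f \<otimes>\<^bsub>R\<^esub> g \<otimes>\<^bsub>R\<^esub> h = f \<otimes>\<^bsub>R\<^esub> (g \<otimes>\<^bsub>R\<^esub> h)"
    proof
      fix x
      show "(f \<otimes>\<^bsub>R\<^esub> g \<otimes>\<^bsub>R\<^esub> h) x = (f \<otimes>\<^bsub>R\<^esub> (g \<otimes>\<^bsub>R\<^esub> h)) x"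
      proof (cases "x \<in> carrier G")
        case x: True
        have "(f \<otimes>\<^bsub>R\<^esub> g \<otimes>\<^bsub>R\<^esub> h) x =
            (\<Sum>y\<in>carrier G. (\<Sum>u\<in>carrier G. f u * g (inv u \<otimes> y)) * h (inv y \<otimes> x))"
          using x by (simp add: mult_R[OF mult_R_closed[OF R(1)]]) (simp add: mult_R[OF R(1)])
        also have "\<dots> = (\<Sum>u\<in>carrier G. f u * (\<Sum>y\<in>carrier G. g (inv u \<otimes> y) * h (inv y \<otimes> x)))"
          by (simp add: sum_distrib_left sum_distrib_right mult.assoc) (rule sum.swap)
        also have "\<dots> = (\<Sum>u\<in>carrier G. f u * (\<Sum>v\<in>carrier G. g v * h (inv v \<otimes> (inv u \<otimes> x))))"
        proof (rule sum.cong[OF refl])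
          fix u assume u: "u \<in> carrier G"
          \<comment> \<open>Substitution \<open>y = u \<otimes> v\<close> in the inner sum.\<close>
          have "(\<Sum>y\<in>carrier G. g (inv u \<otimes> y) * h (inv y \<otimes> x)) =
              (\<Sum>v\<in>carrier G. g (inv u \<otimes> (u \<otimes> v)) * h (inv (u \<otimes> v) \<otimes> x))"
            using u by (rule sum_translate[symmetric])
          also have "\<dots> = (\<Sum>v\<in>carrier G. g v * h (inv v \<otimes> (inv u \<otimes> x)))"
            using u x by (intro sum.cong) (auto simp: inv_mult_group m_assoc simp flip: m_assoc[of "inv u" u])
          finally show "f u * (\<Sum>y\<in>carrier G. g (inv u \<otimes> y) * h (inv y \<otimes> x)) =
              f u * (\<Sum>v\<in>carrier G. g v * h (inv v \<otimes> (inv u \<otimes> x)))" by simp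
        qed
        also have "\<dots> = (f \<otimes>\<^bsub>R\<^esub> (g \<otimes>\<^bsub>R\<^esub> h)) x"
          using R x by (simp add: mult_R)
        finally show ?thesis .
      qed (use R mult_R_closed in \<open>simp add: mem_carrier_R\<close>)
    qed
    show "f \<otimes>\<^bsub>R\<^esub> g = g \<otimes>\<^bsub>R\<^esub> f"
    proof
      fix x
      show "(f \<otimes>\<^bsub>R\<^esub> g) x = (g \<otimes>\<^bsub>R\<^esub> f) x"
      proof (cases "x \<in> carrier G")
        case x: True
        \<comment> \<open>Replacing \<open>y\<close> first by \<open>x \<otimes> y\<close> and then
          by \<open>x \<otimes> inv y\<close> moves the plain argument from \<open>f\<close> to
          \<open>g\<close>.\<close>
        have "(f \<otimes>\<^bsub>R\<^esub> g) x = (\<Sum>y\<in>carrier G. f (x \<otimes> y) * g (inv (x \<otimes> y) \<otimes> x))"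
          using R x sum_translate[OF x, of "\<lambda>y. f y * g (inv y \<otimes> x)"] by (simp add: mult_R)
        also have "\<dots> = (\<Sum>y\<in>carrier G. f (x \<otimes> inv y) * g (inv (x \<otimes> inv y) \<otimes> x))"
          by (rule sum_inv[symmetric])
        also have "\<dots> = (\<Sum>y\<in>carrier G. g y * f (inv y \<otimes> x))"
        proof (rule sum.cong[OF refl])
          fix y assume y: "y \<in> carrier G"
          have "inv (x \<otimes> inv y) \<otimes> x = y" using x y by (simp add: inv_mult_group m_assoc)
          then show "f (x \<otimes> inv y) * g (inv (x \<otimes> inv y) \<otimes> x) = g y * f (inv y \<otimes> x)"
            using x y by (simp add: m_comm[of x])
        qed
        also have "\<dots> = (g \<otimes>\<^bsub>R\<^esub> f) x"
          using R x by (simp add: mult_R)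
        finally show ?thesis .
      qed (use R in \<open>simp add: mult_R\<close>)
    qed
    show "\<one>\<^bsub>R\<^esub> \<otimes>\<^bsub>R\<^esub> f = f"
      using R by (auto simp: one_R group_element_mult mem_carrier_R)
  qed (auto simp: one_R mult_R_closed)
  fix f g h assume R: "f \<in> carrier R" "g \<in> carrier R" "h \<in> carrier R"
  then have "f \<oplus>\<^bsub>R\<^esub> g \<in> carrier R" by (simp add: mem_carrier_R add_R)
  then show "(f \<oplus>\<^bsub>R\<^esub> g) \<otimes>\<^bsub>R\<^esub> h = f \<otimes>\<^bsub>R\<^esub> h \<oplus>\<^bsub>R\<^esub> g \<otimes>\<^bsub>R\<^esub> h"
    using R by (auto simp: mult_R fun_eq_iff) (auto simp: add_R mult_R distrib_right sum.distrib)
qed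

lemma minus_R:
  assumes "f \<in> carrier R" "g \<in> carrier R"
  shows "f \<ominus>\<^bsub>R\<^esub> g = (\<lambda>x. f x - g x)"
proof -
  have "(\<lambda>x. f x - g x) \<oplus>\<^bsub>R\<^esub> g = f" by (simp add: add_R)
  moreover have "(\<lambda>x. f x - g x) \<in> carrier R" using assms by (simp add: mem_carrier_R)
  ultimately show ?thesis using assms
    by (metis R.add.inv_solve_right R.minus_eq)
qed

lemma central_idempotent_iff: "central_idempotent R e \<longleftrightarrow> e \<in> carrier R \<and> e \<otimes>\<^bsub>R\<^esub> e = e"
  by (auto simp: central_idempotent_def R.m_comm)

text \<open>The products \<open>f e\<close> and \<open>f - f e\<close> are orthogonal idempotents
  with sum \<open>f\<close>, so primitivity forces one of them to vanish.\<close>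

lemma primitive_eq_or_annihilates:
  assumes f: "primitive_central_idempotent R f" and e: "central_idempotent R e"
  shows "f \<otimes>\<^bsub>R\<^esub> e = f \<or> f \<otimes>\<^bsub>R\<^esub> e = \<zero>\<^bsub>R\<^esub>"
proof -
  have fc [simp]: "f \<in> carrier R" and ff: "f \<otimes>\<^bsub>R\<^esub> f = f" and ec [simp]: "e \<in> carrier R" and ee: "e \<otimes>\<^bsub>R\<^esub> e = e"
    using f e by (auto simp: primitive_central_idempotent_def central_idempotent_iff)
  let ?a = "f \<otimes>\<^bsub>R\<^esub> e" and ?b = "f \<ominus>\<^bsub>R\<^esub> f \<otimes>\<^bsub>R\<^esub> e"
  have aa: "?a \<otimes>\<^bsub>R\<^esub> ?a = ?a"
    by (metis R.m_assoc R.m_lcomm ec ee fc ff R.m_closed)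
  have fa: "f \<otimes>\<^bsub>R\<^esub> ?a = ?a" "?a \<otimes>\<^bsub>R\<^esub> f = ?a"
    by (metis R.m_assoc ec fc ff) (metis R.m_assoc R.m_comm ec fc ff R.m_closed)
  have ab: "?a \<otimes>\<^bsub>R\<^esub> ?b = \<zero>\<^bsub>R\<^esub>"
    by (simp add: R.minus_eq R.r_distr R.r_minus aa fa R.r_neg)
  have "f \<otimes>\<^bsub>R\<^esub> ?b = ?b"
    by (simp add: R.minus_eq R.r_distr R.r_minus ff fa)
  then have bb: "?b \<otimes>\<^bsub>R\<^esub> ?b = ?b"
    using ab by (simp add: R.minus_eq R.l_distr R.l_minus)
  have split: "f = ?a \<oplus>\<^bsub>R\<^esub> ?b"
    by (simp add: minus_R add_R)
  then have "?a = \<zero>\<^bsub>R\<^esub> \<or> ?b = \<zero>\<^bsub>R\<^esub>"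
    using f aa bb ab unfolding primitive_central_idempotent_def central_idempotent_iff
    by (metis R.m_closed R.minus_closed ec fc)
  then show ?thesis
    by (metis split R.r_zero R.m_closed ec fc)
qed

section \<open>Averages over subgroups\<close>

text \<open>The element written \<open>K\<^sup>-\<close> or \<open>L\<^sup>-\<close> when
  \<open>H\<close> is one of the two kernels of a character; it is idempotent when \<open>H\<close>
  is a subgroup.\<close>

definition average :: "'a set \<Rightarrow> 'a \<Rightarrow> rat" where
  "average H = (\<lambda>x. if x \<in> H then 1 / of_nat (card H) else 0)"

lemma average_closed: "H \<subseteq> carrier G \<Longrightarrow> average H \<in> carrier R"
  by (auto simp: average_def mem_carrier_R)

lemma average_mult:
  assumes H: "subgroup H G" and f: "f \<in> carrier R"
    and inv: "\<And>h x. h \<in> H \<Longrightarrow> x \<in> carrier G \<Longrightarrow> f (h \<otimes> x) = f x"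
  shows "average H \<otimes>\<^bsub>R\<^esub> f = f"
proof
  fix x
  have sub: "H \<subseteq> carrier G" using H by (rule subgroup.subset)
  have "finite H" "H \<noteq> {}"
    using finite_subset[OF sub] subgroup.one_closed[OF H] by auto
  have "(\<Sum>y\<in>carrier G. average H y * f (inv y \<otimes> x)) = f x" if "x \<in> carrier G"
  proof -
    have "(\<Sum>y\<in>carrier G. average H y * f (inv y \<otimes> x)) = (\<Sum>y\<in>H. 1 / of_nat (card H) * f x)"
      using sub that subgroup.m_inv_closed[OF H]
      by (intro sum.mono_neutral_cong_right) (auto simp: average_def inv)
    also have "\<dots> = f x" using \<open>finite H\<close> \<open>H \<noteq> {}\<close> by simp
    finally show ?thesis .
  qed
  then show "(average H \<otimes>\<^bsub>R\<^esub> f) x = f x"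
    using f unfolding mult_R[OF average_closed[OF sub]] by (simp add: mem_carrier_R)
qed

end

section \<open>The dichotomy for idempotents\<close>

text \<open>\<open>ramanujan_sum p q t\<close> is the sum of the \<open>t\<close>-th powers of the primitive
  \<open>(p * q)\<close>-th roots of unity when \<open>q\<close> is a power of the prime \<open>p\<close>.\<close>

definition ramanujan_sum :: "nat \<Rightarrow> nat \<Rightarrow> int \<Rightarrow> rat" where
  "ramanujan_sum p q t = (if int (p * q) dvd t then of_nat (p * q) else 0) - (if int q dvd t then of_nat q else 0)"

lemma ramanujan_sum_mod: "ramanujan_sum p q (t mod int (p * q)) = ramanujan_sum p q t"
  by (simp add: ramanujan_sum_def dvd_mod_iff)

text \<open>The only values are \<open>p * q - q\<close>, \<open>- q\<close> and \<open>0\<close>,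
  and the first differs from the other two. The sum therefore detects whether \<open>t\<close> is
  zero modulo \<open>p * q\<close>.\<close>

lemma ramanujan_sum_eq_0_iff:
  assumes "p > 1" "q > 0"
  shows "ramanujan_sum p q t = of_nat (p * q) - of_nat q \<longleftrightarrow> int (p * q) dvd t"
proof -
  have "int (p * q) dvd t \<Longrightarrow> int q dvd t" by (metis dvd_mult_right of_nat_mult)
  then show ?thesis
    using assms by (auto simp: ramanujan_sum_def)
qed

text \<open>If \<open>q\<close> divides \<open>s\<close>, exactly one \<open>k\<close> makes the
  argument a multiple of \<open>p * q\<close>, and its contribution \<open>p * q\<close> cancels the
  \<open>p\<close> terms \<open>- q\<close>; otherwise every term is zero. For \<open>q\<close> a
  power of the prime \<open>p\<close> this reflects that primitive \<open>(p * q)\<close>-th roots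
  of unity are zeros of \<open>prime_cyclotomic p q\<close>.\<close>

lemma sum_ramanujan_sum:
  assumes "p > 0" "q > 0"
  shows "(\<Sum>k<p. ramanujan_sum p q (s - int (k * q))) = 0"
proof (cases "int q dvd s")
  case True
  then obtain t where t: "s = int q * t" by auto
  define k0 where "k0 = nat (t mod int p)"
  have k0: "k0 < p" using assms by (simp add: k0_def nat_less_iff)
  have "int (p * q) dvd s - int (k * q) \<longleftrightarrow> k = k0" if "k < p" for k
  proof -
    have "s - int (k * q) = int q * (t - int k)" by (simp add: t algebra_simps)
    then have "int (p * q) dvd s - int (k * q) \<longleftrightarrow> int p dvd t - int k"
      using assms by (simp add: mult.commute[of "int p"])
    also have "\<dots> \<longleftrightarrow> t mod int p = int k mod int p"
      by (simp add: mod_eq_dvd_iff)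
    also have "\<dots> \<longleftrightarrow> k = k0"
      using that assms by (auto simp: k0_def)
    finally show ?thesis .
  qed
  moreover have "int q dvd s - int (k * q)" for k using True by simp
  ultimately have "(\<Sum>k<p. ramanujan_sum p q (s - int (k * q))) =
      (\<Sum>k<p. (if k = k0 then of_nat (p * q) else 0) - of_nat q)"
    by (intro sum.cong) (simp_all add: ramanujan_sum_def)
  also have "\<dots> = 0" using k0 by (simp add: sum_subtractf)
  finally show ?thesis .
next
  case False
  have "ramanujan_sum p q (s - int (k * q)) = 0" for k
  proof -
    have "\<not> int q dvd s - int (k * q)"
      using False by (metis dvd_diff_commute dvd_triv_right of_nat_mult zdvd_zdiffD)
    then show ?thesis
      by (auto simp: ramanujan_sum_def dest: dvd_mult_right)
  qed
  then show ?thesis by simp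
qed

text \<open>If \<open>P\<close> is the push-forward of \<open>f\<close> along a character \<open>\<chi>\<close>, this functional computes, up to a
  constant, the value of \<open>f * char_idempotent p q \<chi>\<close> at any \<open>x\<close> with \<open>\<chi> x = s\<close>.\<close>

definition ramanujan_functional :: "nat \<Rightarrow> nat \<Rightarrow> int \<Rightarrow> int poly \<Rightarrow> rat" where
  "ramanujan_functional p q s P = (\<Sum>i\<le>degree P. of_int (coeff P i) * ramanujan_sum p q (s - int i))"

lemma ramanujan_functional_bound:
  "degree P \<le> N \<Longrightarrow>
    ramanujan_functional p q s P = (\<Sum>i\<le>N. of_int (coeff P i) * ramanujan_sum p q (s - int i))"
  unfolding ramanujan_functional_def
  by (intro sum.mono_neutral_left) (auto simp: coeff_eq_0)

lemma ramanujan_functional_add: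
  "ramanujan_functional p q s (P + Q) = ramanujan_functional p q s P + ramanujan_functional p q s Q"
proof -
  let ?N = "max (degree P) (degree Q)"
  show ?thesis
    using degree_add_le_max[of P Q]
    by (simp add: ramanujan_functional_bound[of _ ?N] sum.distrib distrib_right)
qed

lemma ramanujan_functional_monom:
  "ramanujan_functional p q s (monom c n) = of_int c * ramanujan_sum p q (s - int n)"
  by (simp add: ramanujan_functional_bound[of _ n] degree_monom_le if_distrib[of "\<lambda>u. of_int u * _"]
      cong: if_cong)

lemma ramanujan_functional_sum:
  "ramanujan_functional p q s (\<Sum>x\<in>A. P x) = (\<Sum>x\<in>A. ramanujan_functional p q s (P x))"
proof (induction A rule: infinite_finite_induct)
  case empty
  show ?case using ramanujan_functional_monom[of p q s 0 0] by simp
next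
  case (infinite A)
  then show ?case using ramanujan_functional_monom[of p q s 0 0] by simp
qed (simp_all add: ramanujan_functional_add)

text \<open>Each monomial of the cofactor contributes a sum of \<open>ramanujan_sum\<close> over a
  progression of step \<open>q\<close>, which vanishes.\<close>

lemma ramanujan_functional_eq_0:
  assumes "p > 0" "q > 0" "prime_cyclotomic p q dvd P"
  shows "ramanujan_functional p q s P = 0"
proof -
  obtain Q where "P = prime_cyclotomic p q * Q" using assms(3) by blast
  also have "\<dots> = (\<Sum>j\<le>degree Q. \<Sum>k<p. monom (coeff Q j) (j + k * q))"
    by (subst poly_as_sum_of_monoms[of Q, symmetric])
       (simp add: prime_cyclotomic_def sum_product sum.swap[of _ "{..<p}"] mult_monom add.commute)
  finally have P: "P = \<dots>" .
  have "ramanujan_functional p q s P =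
      (\<Sum>j\<le>degree Q. of_int (coeff Q j) * (\<Sum>k<p. ramanujan_sum p q (s - int j - int (k * q))))"
    by (simp add: P ramanujan_functional_sum ramanujan_functional_monom sum_distrib_left algebra_simps)
  then show ?thesis by (simp only: sum_ramanujan_sum[OF assms(1,2)] mult_zero_right sum.neutral_const)
qed

lemma common_denominator:
  assumes "finite A"
  shows "\<exists>D::int. D > 0 \<and> (\<forall>a\<in>A. \<exists>k::int. of_int D * (f a :: rat) = of_int k)"
  using assms
proof (induction A)
  case (insert x A)
  then obtain D where D: "D > 0" "\<And>a. a \<in> A \<Longrightarrow> \<exists>k::int. of_int D * f a = of_int k" by auto
  obtain u v where uv: "f x = of_int u / of_int v" "v > 0"
    by (metis Fract_of_int_quotient Rat_cases)
  have "\<exists>k::int. of_int (D * v) * f a = of_int k" if "a \<in> insert x A" for a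
  proof (cases "a = x")
    case True
    then show ?thesis using uv by (intro exI[of _ "D * u"]) simp
  next
    case False
    then have "a \<in> A" using that by simp
    then obtain k :: int where "of_int D * f a = of_int k" using D(2) by blast
    then show ?thesis by (intro exI[of _ "v * k"]) (simp add: mult_ac)
  qed
  then show ?case using D uv by (intro exI[of _ "D * v"]) auto
qed (auto intro: exI[of _ 1])

text \<open>Exponents may be reduced modulo \<open>m\<close> in \<int>[x]/(x ^ m - 1), as
  \<open>x ^ m\<close> is 1 there.\<close>

lemma monom_mod_dvd:
  "monom 1 m - 1 dvd monom (c :: int) a - monom c (a mod m)"
proof -
  have "monom (1::int) m - 1 dvd monom 1 m ^ (a div m) - 1"
    by (simp add: power_diff_1_eq)
  moreover have "monom c a - monom c (a mod m) = monom c (a mod m) * (monom 1 m ^ (a div m) - 1)"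
    by (simp add: monom_power mult_monom right_diff_distrib)
  ultimately show ?thesis by simp
qed

context finite_comm_group
begin

text \<open>Residues are represented by integers from 0 to \<open>m - 1\<close>. The bounds depend
  on \<open>m > 0\<close>, since \<open>integer_mod_group 0\<close> is the group of all
  integers.\<close>

lemma hom_integer_mod_group_range:
  assumes "\<chi> \<in> hom G (integer_mod_group m)" "m > 0" "x \<in> carrier G"
  shows "0 \<le> \<chi> x" "\<chi> x < int m"
  using hom_in_carrier[OF assms(1,3)] assms(2) by (auto simp: carrier_integer_mod_group)

lemma hom_integer_mod_group_mult:
  assumes "\<chi> \<in> hom G (integer_mod_group m)" "x \<in> carrier G" "y \<in> carrier G"
  shows "\<chi> (x \<otimes> y) = (\<chi> x + \<chi> y) mod int m"
  using hom_mult[OF assms] by simp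

lemma hom_integer_mod_group_inv_mult:
  assumes "\<chi> \<in> hom G (integer_mod_group m)" "m > 0" "x \<in> carrier G" "y \<in> carrier G"
  shows "\<chi> (inv y \<otimes> x) = (\<chi> x - \<chi> y) mod int m"
proof -
  have "\<chi> x = \<chi> (y \<otimes> (inv y \<otimes> x))" using assms by (simp flip: m_assoc)
  also have "\<dots> = (\<chi> y + \<chi> (inv y \<otimes> x)) mod int m"
    using assms by (intro hom_integer_mod_group_mult) auto
  finally have "(\<chi> x - \<chi> y) mod int m = \<chi> (inv y \<otimes> x) mod int m"
    by (simp add: mod_diff_left_eq)
  then show ?thesis
    using hom_integer_mod_group_range[OF assms(1,2), of "inv y \<otimes> x"] assms by simp
qed

definition char_idempotent :: "nat \<Rightarrow> nat \<Rightarrow> ('a \<Rightarrow> int) \<Rightarrow> 'a \<Rightarrow> rat" where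
  "char_idempotent p q \<chi> = (\<lambda>x. if x \<in> carrier G then ramanujan_sum p q (\<chi> x) / of_nat (Coset.order G) else 0)"

lemma char_idempotent_closed: "char_idempotent p q \<chi> \<in> carrier R"
  by (simp add: char_idempotent_def mem_carrier_R)

text \<open>Push \<open>f\<close> forward along \<open>\<chi>\<close> to an element \<open>P\<close> of \<open>\<rat>[x]/(x ^ m - 1)\<close>. Idempotency makes
  the irreducible cyclotomic polynomial divide \<open>P * (P - 1)\<close>, hence \<open>P\<close> or \<open>P - 1\<close>
  (here with denominators cleared by \<open>D\<close>).\<close>

lemma idempotent_mult_char_idempotent:
  assumes p: "prime p" and q: "q = p ^ k" and \<chi>: "\<chi> \<in> hom G (integer_mod_group (p * q))"
    and f: "f \<in> carrier R" and ff: "f \<otimes>\<^bsub>R\<^esub> f = f"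
  shows "f \<otimes>\<^bsub>R\<^esub> char_idempotent p q \<chi> = \<zero>\<^bsub>R\<^esub> \<or>
         f \<otimes>\<^bsub>R\<^esub> char_idempotent p q \<chi> = char_idempotent p q \<chi>"
proof -
  let ?e = "char_idempotent p q \<chi>" and ?m = "p * q"
  have p0: "p > 0" and q0: "q > 0" and m0: "?m > 0" using p q prime_gt_0_nat by auto
  note range = hom_integer_mod_group_range[OF \<chi> m0]
  obtain D :: int where D: "D > 0" and "\<forall>x\<in>carrier G. \<exists>k::int. of_int D * f x = of_int k"
    using common_denominator[OF finite_carrier, of f] by auto
  then obtain F :: "'a \<Rightarrow> int" where F: "\<And>x. x \<in> carrier G \<Longrightarrow> of_int D * f x = of_int (F x)"
    by metis
  define P where "P = (\<Sum>y\<in>carrier G. monom (F y) (nat (\<chi> y)))"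
  \<comment> \<open>The equation \<open>f * f = f\<close> with denominators cleared by
    \<open>D * D\<close>; the left side keeps one factor \<open>D\<close> because only one factor is
    absorbed into \<open>F\<close>.\<close>
  have DF: "D * F x = (\<Sum>y\<in>carrier G. F y * F (inv y \<otimes> x))" if "x \<in> carrier G" for x
  proof -
    have "of_int (D * F x) = of_int D * of_int D * f x"
      using F[OF that] by simp
    also have "f x = (\<Sum>y\<in>carrier G. f y * f (inv y \<otimes> x))"
      using arg_cong[OF ff, of "\<lambda>f. f x"] that f by (simp add: mult_R)
    also have "of_int D * of_int D * \<dots> = (\<Sum>y\<in>carrier G. (of_int D * f y) * (of_int D * f (inv y \<otimes> x)))"
      by (simp add: sum_distrib_left mult_ac)
    also have "\<dots> = (\<Sum>y\<in>carrier G. of_int (F y * F (inv y \<otimes> x)))"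
      using that by (intro sum.cong) (auto simp: F)
    also have "\<dots> = of_int (\<Sum>y\<in>carrier G. F y * F (inv y \<otimes> x))" by simp
    finally show ?thesis by (simp only: of_int_eq_iff)
  qed
  \<comment> \<open>The sum for \<open>D * P\<close> is brought to the form of the double sum for
    \<open>P * P\<close>, the exponents being reduced modulo \<open>?m\<close>.\<close>
  have "[:D:] * P = (\<Sum>x\<in>carrier G. monom (D * F x) (nat (\<chi> x)))"
    by (simp add: P_def sum_distrib_left mult_monom flip: monom_0)
  also have "\<dots> = (\<Sum>x\<in>carrier G. \<Sum>y\<in>carrier G. monom (F y * F (inv y \<otimes> x)) (nat (\<chi> x)))"
    by (intro sum.cong) (simp_all add: DF monom_sum)
  also have "\<dots> = (\<Sum>y\<in>carrier G. \<Sum>x\<in>carrier G. monom (F y * F (inv y \<otimes> x)) (nat (\<chi> x)))"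
    by (rule sum.swap)
  also have "\<dots> = (\<Sum>y\<in>carrier G. \<Sum>z\<in>carrier G. monom (F y * F z) (nat (\<chi> y + \<chi> z) mod ?m))"
  proof (rule sum.cong[OF refl])
    fix y assume y: "y \<in> carrier G"
    have "(\<Sum>x\<in>carrier G. monom (F y * F (inv y \<otimes> x)) (nat (\<chi> x))) =
        (\<Sum>z\<in>carrier G. monom (F y * F (inv y \<otimes> (y \<otimes> z))) (nat (\<chi> (y \<otimes> z))))"
      using y by (rule sum_translate[symmetric])
    also have "\<dots> = (\<Sum>z\<in>carrier G. monom (F y * F z) (nat (\<chi> y + \<chi> z) mod ?m))"
      using y range by (intro sum.cong)
        (auto simp: hom_integer_mod_group_mult[OF \<chi>] nat_mod_distrib nat_mult_distrib simp flip: m_assoc)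
    finally show "(\<Sum>x\<in>carrier G. monom (F y * F (inv y \<otimes> x)) (nat (\<chi> x))) =
      (\<Sum>z\<in>carrier G. monom (F y * F z) (nat (\<chi> y + \<chi> z) mod ?m))" .
  qed
  finally have DP: "[:D:] * P = \<dots>" .
  have PP: "P * P = (\<Sum>y\<in>carrier G. \<Sum>z\<in>carrier G. monom (F y * F z) (nat (\<chi> y + \<chi> z)))"
    using range by (simp add: P_def sum_product mult_monom nat_add_distrib)
  have "monom 1 ?m - 1 dvd P * P - [:D:] * P"
    unfolding PP DP sum_subtractf[symmetric] by (intro dvd_sum monom_mod_dvd)
  then have "prime_cyclotomic p q dvd P * (P - [:D:])"
    using prime_cyclotomic_mult[of q p] by (metis dvd_trans dvd_triv_right mult.commute right_diff_distrib)
  moreover have "prime_elem (prime_cyclotomic p q)"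
    using irreducible_prime_cyclotomic[OF p] by (simp add: q irreducible_imp_prime_elem_gcd)
  ultimately have cases: "prime_cyclotomic p q dvd P \<or> prime_cyclotomic p q dvd P - [:D:]"
    by (rule prime_elem_dvd_multD[rotated])
  let ?n = "of_nat (Coset.order G) :: rat"
  have fe: "of_int D * ?n * (f \<otimes>\<^bsub>R\<^esub> ?e) x = ramanujan_functional p q (\<chi> x) P" if x: "x \<in> carrier G" for x
  proof -
    have n0: "?n \<noteq> 0" by (simp add: order_gt_0_iff_finite)
    have "(f \<otimes>\<^bsub>R\<^esub> ?e) x = (\<Sum>y\<in>carrier G. f y * (ramanujan_sum p q (\<chi> x - \<chi> y) / ?n))"
      using f x by (simp add: mult_R char_idempotent_def hom_integer_mod_group_inv_mult[OF \<chi> m0]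
          ramanujan_sum_mod del: of_nat_mult)
    then have "of_int D * ?n * (f \<otimes>\<^bsub>R\<^esub> ?e) x =
        (\<Sum>y\<in>carrier G. (of_int D * f y) * ramanujan_sum p q (\<chi> x - \<chi> y))"
      using n0 by (simp add: sum_distrib_left mult_ac)
    also have "\<dots> = (\<Sum>y\<in>carrier G. of_int (F y) * ramanujan_sum p q (\<chi> x - int (nat (\<chi> y))))"
      using range by (intro sum.cong) (simp_all add: F)
    also have "\<dots> = ramanujan_functional p q (\<chi> x) P"
      by (simp add: P_def ramanujan_functional_sum ramanujan_functional_monom)
    finally show ?thesis .
  qed
  have Dn: "of_int D * ?n \<noteq> 0" using D by (simp add: order_gt_0_iff_finite)
  have outside: "(f \<otimes>\<^bsub>R\<^esub> ?e) x = 0" "?e x = 0" if "x \<notin> carrier G" for x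
    using that mult_R_closed[OF f] char_idempotent_closed by (auto simp: mem_carrier_R)
  show ?thesis using cases
  proof
    assume "prime_cyclotomic p q dvd P"
    then have "(f \<otimes>\<^bsub>R\<^esub> ?e) x = 0" for x
      using fe[of x] outside[of x] Dn p0 q0 by (cases "x \<in> carrier G") (auto simp: ramanujan_functional_eq_0)
    then show ?thesis by (auto simp: zero_R)
  next
    assume dvd: "prime_cyclotomic p q dvd P - [:D:]"
    have "(f \<otimes>\<^bsub>R\<^esub> ?e) x = ?e x" for x
    proof (cases "x \<in> carrier G")
      case True
      \<comment> \<open>Modulo the cyclotomic polynomial \<open>P\<close> is the constant
        \<open>D\<close>, and the functional sees only this class.\<close>
      have "ramanujan_functional p q (\<chi> x) P =
          ramanujan_functional p q (\<chi> x) (P - [:D:]) + ramanujan_functional p q (\<chi> x) (monom D 0)"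
        by (simp add: monom_0 flip: ramanujan_functional_add)
      also have "\<dots> = of_int D * ramanujan_sum p q (\<chi> x)"
        using dvd p0 q0 by (simp add: ramanujan_functional_eq_0 ramanujan_functional_monom)
      also have "\<dots> = of_int D * ?n * ?e x"
        using True Dn by (simp add: char_idempotent_def)
      finally show ?thesis using fe[OF True] Dn by simp
    qed (simp add: outside)
    then show ?thesis by auto
  qed
qed

end

section \<open>Primitive idempotents and surjective characters\<close>

text \<open>Powers of a generator give a surjection from the residues modulo \<open>m\<close>. Equal
  cardinalities make it injective, and its inverse is the required map.\<close>

lemma cyclic_group_iso_integer_mod_group:
  assumes C: "group C" "cyclic_group C" and m: "Coset.order C = m" "m > 0"
  shows "\<exists>\<theta>. \<theta> \<in> iso C (integer_mod_group m)"
proof -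
  interpret group C by fact
  obtain c where c: "c \<in> carrier C" "carrier C = range (\<lambda>n::int. c [^]\<^bsub>C\<^esub> n)"
    using C(2) by (auto simp: cyclic_group)
  have "finite (carrier C)" using m order_gt_0_iff_finite by metis
  have cm: "c [^]\<^bsub>C\<^esub> m = \<one>\<^bsub>C\<^esub>" 
    using comm_group.power_order_eq_one[OF cyclic_imp_abelian_group[OF C(2)] \<open>finite (carrier C)\<close> c(1)] m
    by (simp add: Coset.order_def)
  have red: "c [^]\<^bsub>C\<^esub> (n mod int m) = c [^]\<^bsub>C\<^esub> n" for n :: int
  proof -
    have "c [^]\<^bsub>C\<^esub> n = c [^]\<^bsub>C\<^esub> (int m * (n div int m) + n mod int m)" by simp
    also have "\<dots> = (c [^]\<^bsub>C\<^esub> int m) [^]\<^bsub>C\<^esub> (n div int m) \<otimes>\<^bsub>C\<^esub> c [^]\<^bsub>C\<^esub> (n mod int m)"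
      using c(1) by (simp only: int_pow_mult[OF c(1)] int_pow_pow[OF c(1)] int_pow_closed)
    also have "\<dots> = c [^]\<^bsub>C\<^esub> (n mod int m)" using c(1) cm by (simp add: int_pow_int)
    finally show ?thesis by simp
  qed
  define \<iota> where "\<iota> = (\<lambda>n::int. c [^]\<^bsub>C\<^esub> n)"
  have "\<iota> \<in> hom (integer_mod_group m) C"
    using c(1) by (intro homI) (simp_all add: \<iota>_def red int_pow_mult)
  moreover have img: "\<iota> ` carrier (integer_mod_group m) = carrier C"
  proof -
    have "\<iota> n \<in> \<iota> ` {0..<int m}" for n
      using m by (intro image_eqI[of _ _ "n mod int m"]) (auto simp: \<iota>_def red)
    then show ?thesis using c m by (auto simp: carrier_integer_mod_group \<iota>_def)
  qed
  moreover have "inj_on \<iota> (carrier (integer_mod_group m))"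
    using img m by (intro eq_card_imp_inj_on) (auto simp: carrier_integer_mod_group Coset.order_def)
  ultimately have "\<iota> \<in> iso (integer_mod_group m) C"
    by (simp add: iso_iff)
  then show ?thesis
    using group.iso_set_sym[OF group_integer_mod_group] by blast
qed

lemma cyclic_integer_mod_group:
  assumes "m > 0"
  shows "cyclic_group (integer_mod_group m)"
proof -
  \<comment> \<open>The generator is \<open>1 mod int m\<close> and not 1, so that the trivial group
    \<open>m = 1\<close> is covered.\<close>
  have "carrier (integer_mod_group m) = range (\<lambda>n::int. (1 mod int m) [^]\<^bsub>integer_mod_group m\<^esub> n)"
  proof -
    have "n \<in> range (\<lambda>n. (n * (1 mod int m)) mod int m)" if "0 \<le> n" "n < int m" for n
      using that by (intro image_eqI[of _ _ n]) (auto simp: mod_mult_right_eq)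
    then show ?thesis
      using assms by (auto simp: carrier_integer_mod_group int_pow_integer_mod_group)
  qed
  moreover have "1 mod int m \<in> carrier (integer_mod_group m)"
    using assms by (simp add: carrier_integer_mod_group)
  ultimately show ?thesis
    unfolding group.cyclic_group[OF group_integer_mod_group] by blast
qed

section \<open>Components attached to surjective characters\<close>

lemma component_group_simps [simp]:
  "carrier (component_group G e) = (\<lambda>g. group_element g \<otimes>\<^bsub>rat_group_algebra G\<^esub> e) ` carrier G"
  "\<one>\<^bsub>component_group G e\<^esub> = e"
  "x \<otimes>\<^bsub>component_group G e\<^esub> y = x \<otimes>\<^bsub>rat_group_algebra G\<^esub> y"
  by (simp_all add: component_group_def)

context finite_comm_group
begin

lemma order_neq_0: "Coset.order G \<noteq> 0"
  using order_gt_0_iff_finite by simp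

text \<open>Translation by an element of \<open>H\<close> preserves \<open>H'\<close>, so the
  average over \<open>H'\<close> is constant on the cosets of \<open>H\<close>.\<close>

lemma average_mult_average:
  assumes H: "subgroup H G" and H': "subgroup H' G" and sub: "H \<subseteq> H'"
  shows "average H \<otimes>\<^bsub>R\<^esub> average H' = average H'"
proof (rule average_mult[OF H average_closed[OF subgroup.subset[OF H']]])
  fix h x assume hx: "h \<in> H" "x \<in> carrier G"
  then have h: "h \<in> H'" "h \<in> carrier G" using sub subgroup.subset[OF H'] by auto
  have "x \<in> H'" if "h \<otimes> x \<in> H'"
  proof -
    have "inv h \<otimes> (h \<otimes> x) \<in> H'"
      using subgroup.m_closed[OF H' subgroup.m_inv_closed[OF H' h(1)] that] .
    then show ?thesis using h hx by (simp flip: m_assoc)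
  qed
  then have "h \<otimes> x \<in> H' \<longleftrightarrow> x \<in> H'"
    using h subgroup.m_closed[OF H'] by blast
  then show "average H' (h \<otimes> x) = average H' x" by (simp add: average_def)
qed

lemma group_element_mult_mult:
  assumes "e \<in> carrier R" "e \<otimes>\<^bsub>R\<^esub> e = e" "g \<in> carrier G" "h \<in> carrier G"
  shows "(group_element g \<otimes>\<^bsub>R\<^esub> e) \<otimes>\<^bsub>R\<^esub> (group_element h \<otimes>\<^bsub>R\<^esub> e) = group_element (g \<otimes> h) \<otimes>\<^bsub>R\<^esub> e"
proof -
  have "(group_element g \<otimes>\<^bsub>R\<^esub> e) \<otimes>\<^bsub>R\<^esub> (group_element h \<otimes>\<^bsub>R\<^esub> e) =
      (group_element g \<otimes>\<^bsub>R\<^esub> group_element h) \<otimes>\<^bsub>R\<^esub> (e \<otimes>\<^bsub>R\<^esub> e)"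
    using assms(1,3,4) by (simp add: R.m_ac)
  then show ?thesis using assms by (simp add: group_element_mult_group_element)
qed

text \<open>Idempotency of \<open>e\<close> makes \<open>g \<mapsto> g e\<close> multiplicative, so
  \<open>G e\<close> is a homomorphic image of \<open>G\<close> with identity
  \<open>e\<close>.\<close>

lemma group_component_group:
  assumes e: "e \<in> carrier R" "e \<otimes>\<^bsub>R\<^esub> e = e"
  shows "group (component_group G e)"
proof -
  let ?C = "component_group G e"
  have "(\<lambda>g. group_element g \<otimes>\<^bsub>R\<^esub> e) \<in> hom G ?C"
    using e by (intro homI) (auto simp: group_element_mult_mult)
  then have "group (?C \<lparr>carrier := (\<lambda>g. group_element g \<otimes>\<^bsub>R\<^esub> e) ` carrier G,
      one := group_element \<one> \<otimes>\<^bsub>R\<^esub> e\<rparr>)"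
    by (rule hom_imp_img_group)
  also have "group_element \<one> \<otimes>\<^bsub>R\<^esub> e = e"
    using e by (simp flip: one_R)
  finally show ?thesis by (simp add: component_group_def)
qed

text \<open>For a character into the residues modulo \<open>p * q\<close>, the choice
  \<open>d = p * q\<close> gives the kernel \<open>K\<close> and \<open>d = q\<close> gives the
  larger subgroup \<open>L\<close>.\<close>

definition mod_kernel :: "('a \<Rightarrow> int) \<Rightarrow> nat \<Rightarrow> 'a set" where
  "mod_kernel \<chi> d = {x \<in> carrier G. int d dvd \<chi> x}"

lemma hom_integer_mod_group_one:
  assumes "\<chi> \<in> hom G (integer_mod_group m)"
  shows "\<chi> \<one> = 0"
  using hom_one[OF assms is_group group_integer_mod_group] by simp

lemma subgroup_mod_kernel:
  assumes \<chi>: "\<chi> \<in> hom G (integer_mod_group m)" and m: "m > 0" and d: "d dvd m"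
  shows "subgroup (mod_kernel \<chi> d) G"
proof (rule subgroupI)
  have d': "int d dvd int m" using d by simp
  show "mod_kernel \<chi> d \<noteq> {}"
    using hom_integer_mod_group_one[OF \<chi>] by (auto simp: mod_kernel_def intro!: exI[of _ \<one>])
  fix x y assume xy: "x \<in> mod_kernel \<chi> d" "y \<in> mod_kernel \<chi> d"
  then show "x \<otimes> y \<in> mod_kernel \<chi> d"
    using d' by (simp add: mod_kernel_def hom_integer_mod_group_mult[OF \<chi>] dvd_mod_iff)
  show "inv x \<in> mod_kernel \<chi> d"
    using xy d' hom_integer_mod_group_inv_mult[OF \<chi> m, of \<one> x] hom_integer_mod_group_one[OF \<chi>]
    by (simp add: mod_kernel_def dvd_mod_iff)
qed (auto simp: mod_kernel_def)

text \<open>The fibres of \<open>\<chi>\<close> modulo \<open>d\<close> are translates of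
  \<open>mod_kernel \<chi> d\<close>. Surjectivity makes all \<open>d\<close> of them nonempty, and
  together they partition \<open>G\<close>.\<close>

lemma card_mod_kernel:
  assumes \<chi>: "\<chi> \<in> epi G (integer_mod_group m)" and m: "m > 0" and d: "d dvd m"
  shows "d * card (mod_kernel \<chi> d) = Coset.order G"
proof -
  have hom: "\<chi> \<in> hom G (integer_mod_group m)" and img: "\<chi> ` carrier G = {0..<int m}"
    using \<chi> m by (auto simp: epi_def carrier_integer_mod_group)
  have d': "int d dvd int m" and d0: "d > 0" using d m by (auto intro: Nat.gr0I)
  have mod: "\<chi> (x \<otimes> y) mod int d = (\<chi> x + \<chi> y) mod int d" if "x \<in> carrier G" "y \<in> carrier G" for x y
    using that d' by (simp add: hom_integer_mod_group_mult[OF hom] mod_mod_cancel)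
  have "card {x \<in> carrier G. \<chi> x mod int d = t} = card (mod_kernel \<chi> d)" if t: "t \<in> {0..<int d}" for t
  proof -
    have "t \<in> \<chi> ` carrier G" using t d m img by (auto dest!: dvd_imp_le)
    then obtain g where g: "g \<in> carrier G" "\<chi> g = t" by auto
    have ginv: "g \<otimes> (inv g \<otimes> x) = x" if "x \<in> carrier G" for x
      using g that by (simp flip: m_assoc)
    have "bij_betw (\<lambda>x. g \<otimes> x) (mod_kernel \<chi> d) {x \<in> carrier G. \<chi> x mod int d = t}"
    proof (rule bij_betwI[of _ _ _ "\<lambda>x. inv g \<otimes> x"])
      show "(\<lambda>x. g \<otimes> x) \<in> mod_kernel \<chi> d \<rightarrow> {x \<in> carrier G. \<chi> x mod int d = t}"
      proof
        fix x assume "x \<in> mod_kernel \<chi> d"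
        then have "x \<in> carrier G" "\<chi> x mod int d = 0" by (auto simp: mod_kernel_def)
        then show "g \<otimes> x \<in> {x \<in> carrier G. \<chi> x mod int d = t}"
          using g t mod[of g x] by (simp add: mod_add_eq[symmetric])
      qed
      show "(\<lambda>x. inv g \<otimes> x) \<in> {x \<in> carrier G. \<chi> x mod int d = t} \<rightarrow> mod_kernel \<chi> d"
      proof
        fix x assume x: "x \<in> {x \<in> carrier G. \<chi> x mod int d = t}"
        then have "int d dvd \<chi> x - t" using t by (simp add: mod_eq_dvd_iff[symmetric])
        then have "int d dvd \<chi> (inv g \<otimes> x)"
          using x g d' by (simp add: hom_integer_mod_group_inv_mult[OF hom m] dvd_mod_iff)
        then show "inv g \<otimes> x \<in> mod_kernel \<chi> d"
          using x g by (simp add: mod_kernel_def)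
      qed
    qed (use g ginv in \<open>auto simp: mod_kernel_def simp flip: m_assoc\<close>)
    then show ?thesis using bij_betw_same_card by metis
  qed
  then have "(\<Sum>t\<in>{0..<int d}. card {x \<in> carrier G. \<chi> x mod int d = t}) = d * card (mod_kernel \<chi> d)"
    by simp
  moreover have "(\<Sum>t\<in>{0..<int d}. \<Sum>x | x \<in> carrier G \<and> \<chi> x mod int d = t. 1) = (\<Sum>x\<in>carrier G. 1::nat)"
    using d0 by (intro sum.group) auto
  ultimately show ?thesis by (simp add: Coset.order_def)
qed

text \<open>The two terms of \<open>ramanujan_sum\<close>, divided by the order of \<open>G\<close>,
  are the reciprocals of the sizes of the two kernels.\<close>

lemma char_idempotent_eq_average:
  assumes \<chi>: "\<chi> \<in> epi G (integer_mod_group (p * q))" and pq: "p > 0" "q > 0"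
  shows "char_idempotent p q \<chi> = average (mod_kernel \<chi> (p * q)) \<ominus>\<^bsub>R\<^esub> average (mod_kernel \<chi> q)"
proof
  fix x
  have sub: "mod_kernel \<chi> d \<subseteq> carrier G" for d by (auto simp: mod_kernel_def)
  have o: "Coset.order G \<noteq> 0" by (simp add: order_neq_0)
  have card: "1 / of_nat (card (mod_kernel \<chi> d)) = (of_nat d / of_nat (Coset.order G) :: rat)"
    if "d dvd p * q" for d
  proof -
    have *: "d * card (mod_kernel \<chi> d) = Coset.order G"
      using card_mod_kernel[OF \<chi> _ that] pq by simp
    then have "d \<noteq> 0" "card (mod_kernel \<chi> d) \<noteq> 0" using o by (metis mult_is_0)+
    then show ?thesis unfolding *[symmetric] by (simp add: field_simps)
  qed
  show "char_idempotent p q \<chi> x = (average (mod_kernel \<chi> (p * q)) \<ominus>\<^bsub>R\<^esub> average (mod_kernel \<chi> q)) x"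
    unfolding minus_R[OF average_closed[OF sub] average_closed[OF sub]]
    by (simp add: char_idempotent_def average_def card ramanujan_sum_def diff_divide_distrib del: of_nat_mult)
       (simp add: mod_kernel_def)
qed

lemma group_element_mult_char_idempotent:
  assumes "\<chi> \<in> hom G (integer_mod_group (p * q))" "p > 0" "q > 0" "g \<in> carrier G"
  shows "group_element g \<otimes>\<^bsub>R\<^esub> char_idempotent p q \<chi> =
    (\<lambda>x. if x \<in> carrier G then ramanujan_sum p q (\<chi> x - \<chi> g) / of_nat (Coset.order G) else 0)"
  using assms by (intro ext)
    (simp add: group_element_mult char_idempotent_def hom_integer_mod_group_inv_mult ramanujan_sum_mod del: of_nat_mult)

lemma group_element_mult_char_idempotent_eq_iff:
  assumes \<chi>: "\<chi> \<in> hom G (integer_mod_group (p * q))" and pq: "p > 1" "q > 0"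
    and gh: "g \<in> carrier G" "h \<in> carrier G"
  shows "group_element g \<otimes>\<^bsub>R\<^esub> char_idempotent p q \<chi> = group_element h \<otimes>\<^bsub>R\<^esub> char_idempotent p q \<chi>
    \<longleftrightarrow> \<chi> g = \<chi> h" (is "?l \<longleftrightarrow> ?r")
proof
  assume ?l
  \<comment> \<open>The coefficient at \<open>g\<close> on the left is the value at 0, which
    \<open>ramanujan_sum\<close> takes only on multiples of \<open>p * q\<close>.\<close>
  from fun_cong[OF this, of g] have "ramanujan_sum p q 0 = ramanujan_sum p q (\<chi> g - \<chi> h)"
    using assms by (simp add: group_element_mult_char_idempotent order_neq_0)
  then have "int (p * q) dvd \<chi> g - \<chi> h"
    using ramanujan_sum_eq_0_iff[OF pq] by (metis dvd_0_right)
  then have "\<chi> g mod int (p * q) = \<chi> h mod int (p * q)"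
    by (simp add: mod_eq_dvd_iff)
  then show ?r
    using hom_integer_mod_group_range[OF \<chi>] gh pq by simp
next
  assume ?r
  then show ?l using assms by (intro ext) (simp add: group_element_mult_char_idempotent)
qed

text \<open>The difference of averages is idempotent since the average over the larger subgroup
  absorbs the other. In a splitting \<open>e1 + e2\<close>, the product of \<open>e1\<close> with
  the sum is \<open>e1\<close>, and the dichotomy leaves only zero or the whole sum.\<close>

lemma primitive_char_idempotent:
  assumes p: "prime p" and q: "q = p ^ k" and \<chi>: "\<chi> \<in> epi G (integer_mod_group (p * q))"
  shows "primitive_central_idempotent R (char_idempotent p q \<chi>)"
proof -
  let ?e = "char_idempotent p q \<chi>" and ?m = "p * q"
  have p1: "p > 1" using p prime_gt_1_nat by blast
  then have pq: "p > 0" "q > 0" "?m > 0" using q by auto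
  have hom: "\<chi> \<in> hom G (integer_mod_group ?m)" using \<chi> by (simp add: epi_def)
  let ?A = "average (mod_kernel \<chi> ?m)" and ?B = "average (mod_kernel \<chi> q)"
  have K: "subgroup (mod_kernel \<chi> ?m) G" and L: "subgroup (mod_kernel \<chi> q) G"
    using subgroup_mod_kernel[OF hom] pq by auto
  have KL: "mod_kernel \<chi> ?m \<subseteq> mod_kernel \<chi> q"
    by (auto simp: mod_kernel_def dest: dvd_mult_right)
  have [simp]: "?A \<in> carrier R" "?B \<in> carrier R"
    by (simp_all add: average_closed subgroup.subset[OF K] subgroup.subset[OF L])
  have AB: "?A \<otimes>\<^bsub>R\<^esub> ?A = ?A" "?A \<otimes>\<^bsub>R\<^esub> ?B = ?B" "?B \<otimes>\<^bsub>R\<^esub> ?B = ?B"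
    using average_mult_average[OF K K] average_mult_average[OF K L KL] average_mult_average[OF L L]
    by simp_all
  then have BA: "?B \<otimes>\<^bsub>R\<^esub> ?A = ?B" using R.m_comm[of ?B ?A] by simp
  have "(?A \<ominus>\<^bsub>R\<^esub> ?B) \<otimes>\<^bsub>R\<^esub> (?A \<ominus>\<^bsub>R\<^esub> ?B) = ?A \<ominus>\<^bsub>R\<^esub> ?B"
    by (simp add: R.minus_eq R.l_distr R.r_distr R.l_minus R.r_minus AB BA R.r_neg)
  then have ee: "?e \<otimes>\<^bsub>R\<^esub> ?e = ?e"
    using char_idempotent_eq_average[OF \<chi> pq(1,2)] by simp
  have "ramanujan_sum p q 0 \<noteq> 0"
    using p1 pq by (simp add: ramanujan_sum_def)
  then have "?e \<one> \<noteq> 0"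
    using hom_integer_mod_group_one[OF hom] by (simp add: char_idempotent_def order_neq_0)
  then have e0: "?e \<noteq> \<zero>\<^bsub>R\<^esub>" by (auto simp: zero_R)
  have indec: "e1 = \<zero>\<^bsub>R\<^esub> \<or> e2 = \<zero>\<^bsub>R\<^esub>"
    if e1: "central_idempotent R e1" and e2: "central_idempotent R e2"
      and e12: "e1 \<otimes>\<^bsub>R\<^esub> e2 = \<zero>\<^bsub>R\<^esub>" "?e = e1 \<oplus>\<^bsub>R\<^esub> e2" for e1 e2
  proof -
    have [simp]: "e1 \<in> carrier R" "e2 \<in> carrier R" and e11: "e1 \<otimes>\<^bsub>R\<^esub> e1 = e1"
      using e1 e2 by (auto simp: central_idempotent_iff)
    have "e1 \<otimes>\<^bsub>R\<^esub> ?e = e1"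
      using e11 e12 by (simp add: R.r_distr)
    moreover have "e1 \<otimes>\<^bsub>R\<^esub> ?e = \<zero>\<^bsub>R\<^esub> \<or> e1 \<otimes>\<^bsub>R\<^esub> ?e = ?e"
      by (rule idempotent_mult_char_idempotent[OF p q hom _ e11]) simp
    ultimately have "e1 = \<zero>\<^bsub>R\<^esub> \<or> e1 = e1 \<oplus>\<^bsub>R\<^esub> e2" using e12 by simp
    then show ?thesis
      by (auto simp: add_R zero_R fun_eq_iff)
  qed
  have "central_idempotent R ?e"
    by (simp add: central_idempotent_iff ee char_idempotent_closed)
  then show ?thesis
    unfolding primitive_central_idempotent_def using e0 indec by blast
qed

lemma component_group_char_idempotent:
  assumes p: "prime p" and q: "q = p ^ k" and \<chi>: "\<chi> \<in> epi G (integer_mod_group (p * q))"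
  shows "cyclic_group (component_group G (char_idempotent p q \<chi>))"
    and "Coset.order (component_group G (char_idempotent p q \<chi>)) = p * q"
proof -
  let ?e = "char_idempotent p q \<chi>" and ?m = "p * q"
  let ?C = "component_group G ?e" and ?Z = "integer_mod_group ?m"
  have p1: "p > 1" using p prime_gt_1_nat by blast
  then have pq: "p > 0" "q > 0" "?m > 0" using q by auto
  have hom: "\<chi> \<in> hom G ?Z" and img: "\<chi> ` carrier G = {0..<int ?m}"
    using \<chi> pq by (auto simp: epi_def carrier_integer_mod_group)
  have e: "?e \<in> carrier R" "?e \<otimes>\<^bsub>R\<^esub> ?e = ?e"
    using primitive_char_idempotent[OF assms]
    by (simp_all add: primitive_central_idempotent_def central_idempotent_iff)
  note eq_iff = group_element_mult_char_idempotent_eq_iff[OF hom p1 pq(2)]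
  \<comment> \<open>An arbitrary section of \<open>\<chi>\<close>. The resulting map
    \<open>\<iota>\<close> does not depend on the choice, because \<open>g e\<close> depends only on
    \<open>\<chi> g\<close>.\<close>
  define \<sigma> where "\<sigma> t = (SOME g. g \<in> carrier G \<and> \<chi> g = t)" for t
  have \<sigma>: "\<sigma> t \<in> carrier G \<and> \<chi> (\<sigma> t) = t" if "t \<in> {0..<int ?m}" for t
  proof -
    have "t \<in> \<chi> ` carrier G" using that img by simp
    then show ?thesis unfolding \<sigma>_def 
      using someI_ex[of "\<lambda>g. g \<in> carrier G \<and> \<chi> g = t"] by blast
  qed
  define \<iota> where "\<iota> t = group_element (\<sigma> t) \<otimes>\<^bsub>R\<^esub> ?e" for t
  have \<iota>: "\<iota> (\<chi> g) = group_element g \<otimes>\<^bsub>R\<^esub> ?e" if "g \<in> carrier G" for g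
  proof -
    have "\<chi> g \<in> {0..<int ?m}" using that img by blast
    then show ?thesis unfolding \<iota>_def using \<sigma> that by (subst eq_iff) auto
  qed
  have carr: "carrier ?Z = \<chi> ` carrier G" using img pq by (simp add: carrier_integer_mod_group)
  have "\<iota> \<in> hom ?Z ?C"
  proof (rule homI)
    show "\<iota> s \<in> carrier ?C" if "s \<in> carrier ?Z" for s
      using that unfolding carr by (auto simp: \<iota>)
    fix s t assume "s \<in> carrier ?Z" "t \<in> carrier ?Z"
    then obtain g h where gh: "g \<in> carrier G" "h \<in> carrier G" "s = \<chi> g" "t = \<chi> h"
      unfolding carr by auto
    have "s \<otimes>\<^bsub>?Z\<^esub> t = \<chi> (g \<otimes> h)"
      using hom_mult[OF hom gh(1,2)] gh by simp
    then show "\<iota> (s \<otimes>\<^bsub>?Z\<^esub> t) = \<iota> s \<otimes>\<^bsub>?C\<^esub> \<iota> t"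
      using gh e by (simp add: \<iota> group_element_mult_mult)
  qed
  moreover have img_\<iota>: "\<iota> ` carrier ?Z = carrier ?C"
    unfolding carr by (auto simp: \<iota> image_image)
  ultimately have "\<iota> \<in> epi ?Z ?C" by (simp add: epi_def)
  then show "cyclic_group ?C"
    using group.cyclic_group_epimorphic_image[OF group_integer_mod_group]
      cyclic_integer_mod_group[OF pq(3)] group_component_group[OF e] by blast
  have "inj_on \<iota> (carrier ?Z)"
    unfolding carr by (rule inj_onI) (auto simp: \<iota> eq_iff)
  then show "Coset.order ?C = ?m"
    unfolding Coset.order_def img_\<iota>[symmetric] using pq by (simp add: card_image carrier_integer_mod_group nat_mult_distrib)
qed

text \<open>The character is \<open>g \<mapsto> g f\<close> followed by an identification of
  \<open>G f\<close> with the residues modulo \<open>p * q\<close>.\<close>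

lemma primitive_eq_char_idempotent:
  assumes p: "prime p" and q: "q = p ^ k"
    and f: "primitive_central_idempotent R f"
    and cyc: "cyclic_group (component_group G f)" and ord: "Coset.order (component_group G f) = p * q"
  shows "\<exists>\<chi> \<in> epi G (integer_mod_group (p * q)). f = char_idempotent p q \<chi>"
proof -
  let ?m = "p * q" and ?C = "component_group G f"
  have p1: "p > 1" using p prime_gt_1_nat by blast
  then have pq: "p > 0" "q > 0" "?m > 0" using q by auto
  have fc [simp]: "f \<in> carrier R" and ff: "f \<otimes>\<^bsub>R\<^esub> f = f" and f0: "f \<noteq> \<zero>\<^bsub>R\<^esub>"
    using f by (simp_all add: primitive_central_idempotent_def central_idempotent_iff)
  interpret C: group ?C using group_component_group[OF fc ff] .
  obtain \<theta> where \<theta>: "\<theta> \<in> iso ?C (integer_mod_group ?m)"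
    using cyclic_group_iso_integer_mod_group[OF C.is_group cyc ord pq(3)] by blast
  define \<chi> where "\<chi> = (\<lambda>g. \<theta> (group_element g \<otimes>\<^bsub>R\<^esub> f))"
  have \<theta>_hom: "\<theta> \<in> hom ?C (integer_mod_group ?m)" and \<theta>_inj: "inj_on \<theta> (carrier ?C)"
    and \<theta>_img: "\<theta> ` carrier ?C = carrier (integer_mod_group ?m)"
    using \<theta> by (auto simp: iso_iff)
  have hom: "\<chi> \<in> hom G (integer_mod_group ?m)"
  proof (rule homI)
    show "\<chi> g \<in> carrier (integer_mod_group ?m)" if "g \<in> carrier G" for g
      using that \<theta>_img by (auto simp: \<chi>_def)
    show "\<chi> (g \<otimes> h) = \<chi> g \<otimes>\<^bsub>integer_mod_group ?m\<^esub> \<chi> h" if "g \<in> carrier G" "h \<in> carrier G" for g h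
      using hom_mult[OF \<theta>_hom, of "group_element g \<otimes>\<^bsub>R\<^esub> f" "group_element h \<otimes>\<^bsub>R\<^esub> f"] that
      by (simp add: \<chi>_def group_element_mult_mult[OF fc ff])
  qed
  have \<chi>: "\<chi> \<in> epi G (integer_mod_group ?m)"
    using hom \<theta>_img by (simp add: epi_def \<chi>_def image_image)
  have \<chi>0: "group_element g \<otimes>\<^bsub>R\<^esub> f = f" if g: "g \<in> carrier G" "\<chi> g = 0" for g
  proof -
    have "\<theta> f = 0"
      using hom_one[OF \<theta>_hom C.is_group group_integer_mod_group] by simp
    moreover have "f \<in> carrier ?C" using C.one_closed by simp
    ultimately show ?thesis
      using g inj_onD[OF \<theta>_inj, of "group_element g \<otimes>\<^bsub>R\<^esub> f" f] by (simp add: \<chi>_def)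
  qed
  let ?e = "char_idempotent p q \<chi>"
  let ?A = "average (mod_kernel \<chi> ?m)" and ?B = "average (mod_kernel \<chi> q)"
  have K: "subgroup (mod_kernel \<chi> ?m) G" and L: "subgroup (mod_kernel \<chi> q) G"
    using subgroup_mod_kernel[OF hom] pq by auto
  have [simp]: "?A \<in> carrier R" "?B \<in> carrier R"
    by (simp_all add: average_closed subgroup.subset[OF K] subgroup.subset[OF L])
  have ec: "?e \<in> carrier R" by (rule char_idempotent_closed)
  have Af: "?A \<otimes>\<^bsub>R\<^esub> f = f"
  proof (rule average_mult[OF K fc])
    fix h x assume hx: "h \<in> mod_kernel \<chi> ?m" "x \<in> carrier G"
    \<comment> \<open>The inverse is used because multiplying by \<open>inv h\<close> translates the
      argument of \<open>f\<close> by \<open>h\<close>.\<close>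
    then have "inv h \<in> mod_kernel \<chi> ?m" by (simp add: subgroup.m_inv_closed[OF K])
    then have h: "inv h \<in> carrier G" "\<chi> (inv h) = 0"
      using hom_integer_mod_group_range[OF hom pq(3), of "inv h"]
      by (auto simp: mod_kernel_def zdvd_not_zless order.order_iff_strict)
    have h': "h \<in> carrier G" using hx by (simp add: mod_kernel_def)
    show "f (h \<otimes> x) = f x"
      using fun_cong[OF \<chi>0[OF h], of x] hx h h' by (simp add: group_element_mult)
  qed
  \<comment> \<open>Otherwise an element \<open>l\<close> with \<open>\<chi> l = q\<close>, which
    lies in the larger subgroup, would fix \<open>f\<close>, although \<open>q\<close> is nonzero
    modulo \<open>p * q\<close>.\<close>
  have "?B \<otimes>\<^bsub>R\<^esub> f \<noteq> f"
  proof
    assume Bf: "?B \<otimes>\<^bsub>R\<^esub> f = f"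
    have "int q \<in> \<chi> ` carrier G"
      using \<chi> p1 pq by (auto simp: epi_def carrier_integer_mod_group)
    then obtain l where l: "l \<in> carrier G" "\<chi> l = int q" by auto
    have "group_element l \<otimes>\<^bsub>R\<^esub> ?B = ?B"
    proof -
      have "inv l \<in> mod_kernel \<chi> q"
        using l by (intro subgroup.m_inv_closed[OF L]) (simp add: mod_kernel_def)
      then have "inv l \<otimes> x \<in> mod_kernel \<chi> q \<longleftrightarrow> x \<in> mod_kernel \<chi> q" if "x \<in> carrier G" for x
        using that l hom pq by (auto simp: mod_kernel_def hom_integer_mod_group_inv_mult dvd_mod_iff dvd_diff_left_iff)
      then show ?thesis
        using l by (auto simp: group_element_mult average_def mod_kernel_def fun_eq_iff)
    qed
    then have "group_element l \<otimes>\<^bsub>R\<^esub> f = f"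
      by (metis Bf R.m_assoc \<open>?B \<in> carrier R\<close> fc group_element_closed l(1))
    then have "\<chi> l = \<theta> f" by (simp add: \<chi>_def)
    also have "\<theta> f = 0" using hom_one[OF \<theta>_hom C.is_group group_integer_mod_group] by simp
    finally show False using l pq by simp
  qed
  moreover have "central_idempotent R ?B"
    by (simp add: central_idempotent_iff average_mult_average[OF L L])
  ultimately have Bf: "?B \<otimes>\<^bsub>R\<^esub> f = \<zero>\<^bsub>R\<^esub>"
    using primitive_eq_or_annihilates[OF f, of ?B] R.m_comm[of ?B f] by simp
  have "f \<otimes>\<^bsub>R\<^esub> ?e = ?e \<otimes>\<^bsub>R\<^esub> f"
    by (rule R.m_comm[OF fc ec])
  also have "\<dots> = f"
    unfolding char_idempotent_eq_average[OF \<chi> pq(1,2)]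
    by (simp add: R.minus_eq R.l_distr R.l_minus Af Bf)
  finally have "f \<otimes>\<^bsub>R\<^esub> ?e = f" .
  then have "f = ?e"
    using idempotent_mult_char_idempotent[OF p q hom fc ff] f0 by auto
  then show ?thesis using \<chi> by blast
qed

end

section \<open>Counting characters\<close>

text \<open>Membership in \<open>hom\<close> leaves the values off the carrier free; fixing them
  makes each homomorphism count once.\<close>

definition extensional_hom :: "('a, 'b) monoid_scheme \<Rightarrow> ('c, 'd) monoid_scheme \<Rightarrow> ('a \<Rightarrow> 'c) set" where
  "extensional_hom G H = hom G H \<inter> extensional (carrier G)"

lemma restrict_in_hom:
  assumes "group G" "f \<in> hom G H"
  shows "restrict f (carrier G) \<in> hom G H"
  using assms by (auto simp: hom_def group.is_monoid monoid.m_closed)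

lemma finite_extensional_hom:
  assumes "finite (carrier G)" "finite (carrier H)"
  shows "finite (extensional_hom G H)"
  by (rule finite_subset[OF _ finite_PiE[of "carrier G" "\<lambda>_. carrier H"]])
     (use assms in \<open>auto simp: extensional_hom_def hom_def PiE_def\<close>)

section \<open>Residues modulo prime powers\<close>

lemma card_multiples:
  assumes "d > 0"
  shows "card {u \<in> {0..<int (d * q)}. int d dvd u} = q"
proof -
  have "{u \<in> {0..<int (d * q)}. int d dvd u} = (\<lambda>j. int d * j) ` {0..<int q}"
    using assms by (auto simp: mult_less_cancel_left elim!: dvdE)
      (smt (verit) imageI atLeastLessThan_iff mult_nonneg_nonneg zero_le_mult_iff of_nat_0_less_iff)
  moreover have "inj_on (\<lambda>j. int d * j) {0..<int q}"
    using assms by (auto intro: inj_onI)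
  ultimately show ?thesis by (simp add: card_image)
qed

lemma card_nonmultiples:
  assumes "d > 0"
  shows "card {u \<in> {0..<int (d * q)}. \<not> int d dvd u} = d * q - q"
proof -
  have "{u \<in> {0..<int (d * q)}. \<not> int d dvd u} = {0..<int (d * q)} - {u \<in> {0..<int (d * q)}. int d dvd u}"
    by auto
  moreover have "card ({0..<int (d * q)} - {u \<in> {0..<int (d * q)}. int d dvd u}) =
      card {0..<int (d * q)} - card {u \<in> {0..<int (d * q)}. int d dvd u}"
    by (rule card_Diff_subset) (auto intro: finite_subset[of _ "{0..<int (d * q)}"] simp del: of_nat_mult)
  ultimately show ?thesis
    using card_multiples[OF assms] by (simp only: card_atLeastLessThan_int diff_0_right nat_int)
qed

lemma dvd_mult_nonmultiple:
  fixes u :: int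
  assumes "prime p" "\<not> int p dvd u"
  shows "int (p ^ j) dvd u * t \<longleftrightarrow> int (p ^ j) dvd t"
proof -
  have "coprime (int p) u" using assms by (intro prime_imp_coprime) auto
  then have "coprime (int (p ^ j)) u" by simp
  then show ?thesis by (rule coprime_dvd_mult_right_iff)
qed

lemma mult_nonmultiple_image:
  fixes u :: int
  assumes "prime p" "\<not> int p dvd u"
  shows "(\<lambda>s. (u * s) mod int (p ^ j)) ` {0..<int (p ^ j)} = {0..<int (p ^ j)}"
proof (rule endo_inj_surj)
  let ?m = "int (p ^ j)"
  have m: "?m > 0" using assms prime_gt_0_nat by simp
  show "(\<lambda>s. (u * s) mod ?m) ` {0..<?m} \<subseteq> {0..<?m}" using m by auto
  show "inj_on (\<lambda>s. (u * s) mod ?m) {0..<?m}"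
  proof (rule inj_onI)
    fix s t assume st: "s \<in> {0..<?m}" "t \<in> {0..<?m}" "(u * s) mod ?m = (u * t) mod ?m"
    then have "?m dvd u * (s - t)" by (simp add: mod_eq_dvd_iff right_diff_distrib)
    then have "s mod ?m = t mod ?m"
      using dvd_mult_nonmultiple[OF assms] by (simp add: mod_eq_dvd_iff)
    then show "s = t" using st by simp
  qed
qed simp

section \<open>Surjective characters and the fibres over their idempotents\<close>

context finite_comm_group
begin

lemma hom_integer_mod_group_pow:
  assumes "\<chi> \<in> hom G (integer_mod_group m)" "m > 0" "x \<in> carrier G"
  shows "\<chi> (x [^] n) = (int n * \<chi> x) mod int m"
proof (induction n)
  case 0
  show ?case using hom_integer_mod_group_one[OF assms(1)] by simp
next
  case (Suc n)
  then show ?case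
    using assms by (simp add: hom_integer_mod_group_mult mod_add_left_eq mod_add_right_eq algebra_simps)
qed

text \<open>A residue prime to \<open>p\<close> generates the whole target. The exponent
  \<open>Suc k\<close> excludes the trivial target, onto which the zero map is surjective.\<close>

lemma epi_integer_mod_group_iff:
  assumes p: "prime p" and \<chi>: "\<chi> \<in> hom G (integer_mod_group (p ^ Suc k))"
  shows "\<chi> \<in> epi G (integer_mod_group (p ^ Suc k)) \<longleftrightarrow> (\<exists>x\<in>carrier G. \<not> int p dvd \<chi> x)"
proof
  let ?m = "p ^ Suc k"
  have p1: "p > 1" using p prime_gt_1_nat by blast
  have m: "?m > 0" using p1 by simp
  {
    assume "\<chi> \<in> epi G (integer_mod_group ?m)"
    then have "\<chi> ` carrier G = {0..<int ?m}"
      using m by (simp add: epi_def carrier_integer_mod_group)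
    moreover have "1 \<in> {0..<int ?m}" using p1 one_less_power[of "int p" "Suc k"] by simp
    ultimately obtain x where "x \<in> carrier G" "\<chi> x = 1" by (metis imageE)
    then show "\<exists>x\<in>carrier G. \<not> int p dvd \<chi> x" using p1 by (intro bexI[of _ x]) auto
  next
    assume "\<exists>x\<in>carrier G. \<not> int p dvd \<chi> x"
    then obtain x where x: "x \<in> carrier G" "\<not> int p dvd \<chi> x" by auto
    have "t \<in> \<chi> ` carrier G" if "t \<in> {0..<int ?m}" for t
    proof -
      have "t \<in> (\<lambda>s. (\<chi> x * s) mod int ?m) ` {0..<int ?m}"
        using that unfolding mult_nonmultiple_image[OF p x(2)] .
      then obtain s where s: "s \<in> {0..<int ?m}" "t = (\<chi> x * s) mod int ?m"
        by blast
      then have "t = \<chi> (x [^] nat s)"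
        using hom_integer_mod_group_pow[OF \<chi> m x(1), of "nat s"] by (simp add: mult.commute)
      then show ?thesis using x by auto
    qed
    then show "\<chi> \<in> epi G (integer_mod_group ?m)"
      using \<chi> m hom_carrier[OF \<chi>] by (auto simp: epi_def carrier_integer_mod_group)
  }
qed

lemma char_idempotent_eq_dvd_iff:
  assumes p: "p > 1" and q: "q > 0"
    and eq: "char_idempotent p q \<chi> = char_idempotent p q \<psi>" and x: "x \<in> carrier G"
  shows "int (p * q) dvd \<chi> x \<longleftrightarrow> int (p * q) dvd \<psi> x"
proof -
  have "ramanujan_sum p q (\<chi> x) = ramanujan_sum p q (\<psi> x)"
    using fun_cong[OF eq, of x] x order_neq_0 by (simp add: char_idempotent_def)
  then show ?thesis using ramanujan_sum_eq_0_iff[OF p q] by metis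
qed

text \<open>Two surjective characters with the same kernel differ by an automorphism of the cyclic target.\<close>

lemma card_char_idempotent_fibre:
  assumes p: "prime p" and q: "q = p ^ k"
    and \<chi>: "\<chi> \<in> epi G (integer_mod_group (p * q))"
  shows "card {\<psi> \<in> epi G (integer_mod_group (p * q)) \<inter> extensional (carrier G).
    char_idempotent p q \<psi> = char_idempotent p q \<chi>} = p * q - q" (is "card ?F = _")
proof -
  let ?m = "p * q"
  let ?U = "{u \<in> {0..<int ?m}. \<not> int p dvd u}"
  let ?h = "\<lambda>u. \<lambda>x\<in>carrier G. (u * \<chi> x) mod int ?m"
  have p1: "p > 1" using p prime_gt_1_nat by blast
  then have pq: "p > 0" "q > 0" "?m > 0" using q by auto
  have m: "?m = p ^ Suc k" by (simp add: q)
  have hom: "\<chi> \<in> hom G (integer_mod_group ?m)" using \<chi> by (simp add: epi_def)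
  have img: "\<chi> ` carrier G = {0..<int ?m}"
    using \<chi> pq by (simp add: epi_def carrier_integer_mod_group)
  have m1: "int ?m > 1" using p1 one_less_power[of "int p" "Suc k"] m by simp
  then have "1 \<in> \<chi> ` carrier G" using img by simp
  \<comment> \<open>Evaluation at \<open>x1\<close> recovers the multiplier \<open>u\<close>, and
    the powers of \<open>x1\<close> realise every value of \<open>\<chi>\<close>.\<close>
  then obtain x1 where x1: "x1 \<in> carrier G" "\<chi> x1 = 1" by (metis imageE)
  have "bij_betw ?h ?U ?F"
  proof (rule bij_betw_imageI)
    show "inj_on ?h ?U"
      using x1 by (auto intro!: inj_onI dest!: fun_cong[of _ _ x1])
    show "?h ` ?U = ?F"
    proof (rule equalityI; rule subsetI)
      fix \<psi> assume "\<psi> \<in> ?h ` ?U"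
      then obtain u where u: "u \<in> {0..<int ?m}" "\<not> int p dvd u" "\<psi> = ?h u" by blast
      have "(\<lambda>x. (u * \<chi> x) mod int ?m) \<in> hom G (integer_mod_group ?m)"
      proof (rule homI)
        fix x y assume xy: "x \<in> carrier G" "y \<in> carrier G"
        show "(u * \<chi> x) mod int ?m \<in> carrier (integer_mod_group ?m)"
          using pq by (simp add: carrier_integer_mod_group)
        have "(u * \<chi> (x \<otimes> y)) mod int ?m = (u * (\<chi> x + \<chi> y)) mod int ?m"
          using xy by (simp only: hom_integer_mod_group_mult[OF hom] mod_mult_right_eq)
        also have "\<dots> = ((u * \<chi> x) mod int ?m + (u * \<chi> y) mod int ?m) mod int ?m"
          by (simp only: distrib_left mod_add_eq)
        finally show "(u * \<chi> (x \<otimes> y)) mod int ?m =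
            (u * \<chi> x) mod int ?m \<otimes>\<^bsub>integer_mod_group ?m\<^esub> ((u * \<chi> y) mod int ?m)"
          by (simp only: mult_integer_mod_group)
      qed
      then have \<psi>_hom: "\<psi> \<in> hom G (integer_mod_group ?m)"
        unfolding u(3) by (rule restrict_in_hom[OF is_group])
      have "\<psi> x1 = u" using u x1 by simp
      then have "\<psi> \<in> epi G (integer_mod_group ?m)"
        using epi_integer_mod_group_iff[OF p, of \<psi> k] \<psi>_hom u x1 unfolding m by metis
      moreover have "ramanujan_sum p q (\<psi> x) = ramanujan_sum p q (\<chi> x)" if "x \<in> carrier G" for x
      proof -
        have "ramanujan_sum p q (\<psi> x) = ramanujan_sum p q (u * \<chi> x)"
          using that u(3) by (simp add: ramanujan_sum_mod del: of_nat_mult)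
        also have "\<dots> = ramanujan_sum p q (\<chi> x)"
          using dvd_mult_nonmultiple[OF p u(2), of "Suc k" "\<chi> x"] dvd_mult_nonmultiple[OF p u(2), of k "\<chi> x"]
          unfolding ramanujan_sum_def m q by simp
        finally show ?thesis .
      qed
      then have "char_idempotent p q \<psi> = char_idempotent p q \<chi>"
        by (auto simp: char_idempotent_def)
      ultimately show "\<psi> \<in> ?F" using u(3) by simp
    next
      fix \<psi> assume \<psi>: "\<psi> \<in> ?F"
      then have \<psi>_hom: "\<psi> \<in> hom G (integer_mod_group ?m)" by (simp add: epi_def)
      note range = hom_integer_mod_group_range[OF hom pq(3)] hom_integer_mod_group_range[OF \<psi>_hom pq(3)]
      define u where "u = \<psi> x1"
      have \<psi>_eq: "\<psi> x = (u * \<chi> x) mod int ?m" if x: "x \<in> carrier G" for x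
      proof -
        \<comment> \<open>The elements \<open>?y\<close> and \<open>x\<close> agree under
          \<open>\<chi>\<close>, so they differ by an element of its kernel. Equality of the
          idempotents puts that element into the kernel of \<open>\<psi>\<close> too.\<close>
        let ?y = "x1 [^] nat (\<chi> x)"
        have y: "?y \<in> carrier G" using x1 by simp
        have "\<chi> ?y = \<chi> x"
          using hom_integer_mod_group_pow[OF hom pq(3) x1(1), of "nat (\<chi> x)"] range x x1 by simp
        then have "\<chi> (inv ?y \<otimes> x) = 0"
          using hom_integer_mod_group_inv_mult[OF hom pq(3) x y] by simp
        then have "int ?m dvd \<psi> (inv ?y \<otimes> x)"
          using char_idempotent_eq_dvd_iff[of p q \<psi> \<chi> "inv ?y \<otimes> x"] \<psi> p1 pq x y by simp
        then have "int ?m dvd \<psi> x - \<psi> ?y"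
          by (simp only: hom_integer_mod_group_inv_mult[OF \<psi>_hom pq(3) x y] dvd_mod_iff dvd_refl)
        then have "\<psi> x mod int ?m = \<psi> ?y mod int ?m" by (simp add: mod_eq_dvd_iff)
        also have "\<psi> ?y = (u * \<chi> x) mod int ?m"
          using hom_integer_mod_group_pow[OF \<psi>_hom pq(3) x1(1), of "nat (\<chi> x)"] range x
          by (simp add: u_def mult.commute)
        finally show ?thesis using range x by simp
      qed
      have "\<not> int p dvd u"
      proof
        assume "int p dvd u"
        then have "int p dvd \<psi> x" if "x \<in> carrier G" for x
          using \<psi>_eq[OF that] by (simp add: dvd_mod_iff)
        then show False
          using epi_integer_mod_group_iff[OF p, of \<psi> k] \<psi> \<psi>_hom unfolding m by auto
      qed
      moreover have "\<psi> = ?h u"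
        using \<psi> \<psi>_eq by (intro extensionalityI[of _ "carrier G"]) auto
      moreover have "u \<in> {0..<int ?m}"
        using range(3,4)[OF x1(1)] by (simp add: u_def)
      ultimately show "\<psi> \<in> ?h ` ?U" by blast
    qed
  qed
  from bij_betw_same_card[OF this] show ?thesis
    using card_nonmultiples[OF pq(1), of q] by simp
qed

text \<open>Surjective characters are counted by the idempotent they give: every wanted idempotent
  occurs, and all fibres have the same size.\<close>

lemma card_epi_integer_mod_group:
  assumes p: "prime p"
  shows "card (epi G (integer_mod_group (p ^ Suc k)) \<inter> extensional (carrier G)) =
    (p ^ Suc k - p ^ k) * wedderburn_coeff G (p ^ Suc k)"
proof -
  let ?q = "p ^ k" and ?Z = "integer_mod_group (p ^ Suc k)"
  let ?A = "epi G ?Z \<inter> extensional (carrier G)"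
  have m: "p ^ Suc k = p * ?q" by simp
  have m0: "p ^ Suc k > 0" using p prime_gt_0_nat by simp
  have "?A \<subseteq> extensional_hom G ?Z" by (auto simp: extensional_hom_def epi_def)
  then have fin: "finite ?A"
    using m0 by (intro finite_subset[OF _ finite_extensional_hom]) (auto simp: carrier_integer_mod_group)
  have "{e. primitive_central_idempotent R e \<and> cyclic_group (component_group G e) \<and>
      Coset.order (component_group G e) = p ^ Suc k} = char_idempotent p ?q ` ?A" (is "?W = _")
  proof (rule equalityI; rule subsetI)
    fix e assume "e \<in> ?W"
    then obtain \<chi> where \<chi>: "\<chi> \<in> epi G ?Z" "e = char_idempotent p ?q \<chi>"
      using primitive_eq_char_idempotent[OF p refl, of e k] unfolding m by blast
    then have "restrict \<chi> (carrier G) \<in> ?A"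
      by (auto simp: epi_def restrict_in_hom)
    moreover have "e = char_idempotent p ?q (restrict \<chi> (carrier G))"
      by (auto simp: \<chi> char_idempotent_def)
    ultimately show "e \<in> char_idempotent p ?q ` ?A" by blast
  next
    fix e assume "e \<in> char_idempotent p ?q ` ?A"
    then show "e \<in> ?W"
      using primitive_char_idempotent[OF p refl] component_group_char_idempotent[OF p refl] unfolding m by blast
  qed
  then have W: "wedderburn_coeff G (p ^ Suc k) = card (char_idempotent p ?q ` ?A)"
    by (simp add: wedderburn_coeff_def)
  have "card ?A = (\<Sum>e\<in>char_idempotent p ?q ` ?A. card {\<chi> \<in> ?A. char_idempotent p ?q \<chi> = e})"
    using sum.image_gen[OF fin, of "\<lambda>_. 1::nat" "char_idempotent p ?q"] by simp
  also have "\<dots> = (\<Sum>e\<in>char_idempotent p ?q ` ?A. p ^ Suc k - p ^ k)"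
    using card_char_idempotent_fibre[OF p refl] unfolding m by (intro sum.cong) auto
  finally show ?thesis unfolding W by (simp only: sum_constant of_nat_id mult.commute)
qed

text \<open>A character that is not surjective has all values divisible by \<open>p\<close>, and
  division by \<open>p\<close> turns it into a character with values modulo
  \<open>p ^ k\<close>.\<close>

lemma card_extensional_hom_diff:
  assumes p: "prime p"
  shows "card (extensional_hom G (integer_mod_group (p ^ Suc k))) =
    card (extensional_hom G (integer_mod_group (p ^ k))) + (p ^ Suc k - p ^ k) * wedderburn_coeff G (p ^ Suc k)"
proof -
  let ?Z = "integer_mod_group (p ^ Suc k)" and ?Y = "integer_mod_group (p ^ k)"
  let ?A = "epi G ?Z \<inter> extensional (carrier G)"
  let ?B = "{\<chi> \<in> extensional_hom G ?Z. \<forall>x\<in>carrier G. int p dvd \<chi> x}"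
  have p0: "p > 0" using p prime_gt_0_nat by simp
  have Z: "carrier ?Z = {0..<int (p ^ Suc k)}" and Y: "carrier ?Y = {0..<int (p ^ k)}"
    using p0 by (auto simp: carrier_integer_mod_group)
  have fin: "finite (extensional_hom G ?Z)"
    by (rule finite_extensional_hom) (simp_all only: Z finite_carrier finite_atLeastLessThan_int)
  have "extensional_hom G ?Z = ?A \<union> ?B"
    using epi_integer_mod_group_iff[OF p] by (auto simp: extensional_hom_def epi_def)
  moreover have "?A \<inter> ?B = {}"
    using epi_integer_mod_group_iff[OF p] by (auto simp: extensional_hom_def)
  moreover have "?A \<subseteq> extensional_hom G ?Z" by (auto simp: extensional_hom_def epi_def)
  ultimately have "card (extensional_hom G ?Z) = card ?A + card ?B"
    using fin by (metis (no_types, lifting) card_Un_disjoint finite_Un)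
  moreover have "bij_betw (\<lambda>\<chi>. \<lambda>x\<in>carrier G. int p * \<chi> x) (extensional_hom G ?Y) ?B"
  proof (rule bij_betwI[of _ _ _ "\<lambda>\<chi>. \<lambda>x\<in>carrier G. \<chi> x div int p"])
    show "(\<lambda>\<chi>. \<lambda>x\<in>carrier G. int p * \<chi> x) \<in> extensional_hom G ?Y \<rightarrow> ?B"
    proof
      fix \<chi> assume "\<chi> \<in> extensional_hom G ?Y"
      then have \<chi>: "\<chi> \<in> hom G ?Y" by (simp add: extensional_hom_def)
      have "(\<lambda>x. int p * \<chi> x) \<in> hom G ?Z"
        using p0 hom_integer_mod_group_range[OF \<chi>]
        by (intro homI) (auto simp: carrier_integer_mod_group hom_integer_mod_group_mult[OF \<chi>] mult_mod_right distrib_left)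
      then show "(\<lambda>x\<in>carrier G. int p * \<chi> x) \<in> ?B"
        by (simp add: extensional_hom_def restrict_in_hom)
    qed
    show "(\<lambda>\<chi>. \<lambda>x\<in>carrier G. \<chi> x div int p) \<in> ?B \<rightarrow> extensional_hom G ?Y"
    proof
      fix \<chi> assume \<chi>': "\<chi> \<in> ?B"
      then have \<chi>: "\<chi> \<in> hom G ?Z" by (simp add: extensional_hom_def)
      define \<psi> where "\<psi> x = \<chi> x div int p" for x
      have \<chi>\<psi>: "\<chi> x = int p * \<psi> x" if "x \<in> carrier G" for x
        using \<chi>' that by (simp add: \<psi>_def)
      have "\<psi> \<in> hom G ?Y"
      proof (rule homI)
        fix x y assume xy: "x \<in> carrier G" "y \<in> carrier G"
        show "\<psi> x \<in> carrier ?Y"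
          using hom_integer_mod_group_range[OF \<chi> _ xy(1)] p0 \<chi>\<psi>[OF xy(1)]
          by (simp add: Y zero_le_mult_iff)
        have "int p * \<psi> (x \<otimes> y) = (int p * \<psi> x + int p * \<psi> y) mod int (p ^ Suc k)"
          using xy hom_integer_mod_group_mult[OF \<chi> xy] by (simp flip: \<chi>\<psi>)
        also have "\<dots> = int p * ((\<psi> x + \<psi> y) mod int (p ^ k))"
          by (simp add: mult_mod_right distrib_left)
        finally show "\<psi> (x \<otimes> y) = \<psi> x \<otimes>\<^bsub>?Y\<^esub> \<psi> y"
          using p0 by simp
      qed
      then show "(\<lambda>x\<in>carrier G. \<chi> x div int p) \<in> extensional_hom G ?Y"
        by (simp add: extensional_hom_def restrict_in_hom \<psi>_def[abs_def])
    qed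
  qed (use p0 in \<open>auto simp: extensional_hom_def intro!: extensionalityI[of _ "carrier G"]\<close>)
  ultimately show ?thesis
    using card_epi_integer_mod_group[OF p, of k] bij_betw_same_card by fastforce
qed

end

section \<open>Homomorphisms from products of cyclic groups\<close>

lemma extensional_hom_compose:
  assumes "group G" "f \<in> hom G H" "\<chi> \<in> extensional_hom H A"
  shows "(\<lambda>x\<in>carrier G. \<chi> (f x)) \<in> extensional_hom G A"
  using assms restrict_in_hom[OF assms(1) hom_compose[OF assms(2), of \<chi> A]]
  by (simp add: extensional_hom_def comp_def)

lemma card_extensional_hom_iso:
  assumes "group G" "group H" "G \<cong> H"
  shows "card (extensional_hom G A) = card (extensional_hom H A)"
proof -
  obtain f where f: "f \<in> iso G H" using assms(3) by (auto simp: is_iso_def)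
  define g where "g = inv_into (carrier G) f"
  have g: "g \<in> iso H G" unfolding g_def by (rule group.iso_set_sym[OF assms(1) f])
  have f_hom: "f \<in> hom G H" and f_inj: "inj_on f (carrier G)" and f_img: "f ` carrier G = carrier H"
    using f by (auto simp: iso_iff)
  have g_hom: "g \<in> hom H G" using g by (auto simp: iso_iff)
  have gf: "g (f x) = x" if "x \<in> carrier G" for x
    using f_inj that by (simp add: g_def)
  have fg: "f (g y) = y" if "y \<in> carrier H" for y
    using f_img that by (simp add: g_def f_inv_into_f)
  have "bij_betw (\<lambda>\<chi>. \<lambda>y\<in>carrier H. \<chi> (g y)) (extensional_hom G A) (extensional_hom H A)"
  proof (rule bij_betwI[of _ _ _ "\<lambda>\<chi>. \<lambda>x\<in>carrier G. \<chi> (f x)"])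
    show "(\<lambda>\<chi>. \<lambda>y\<in>carrier H. \<chi> (g y)) \<in> extensional_hom G A \<rightarrow> extensional_hom H A"
      using extensional_hom_compose[OF assms(2) g_hom] by blast
    show "(\<lambda>\<chi>. \<lambda>x\<in>carrier G. \<chi> (f x)) \<in> extensional_hom H A \<rightarrow> extensional_hom G A"
      using extensional_hom_compose[OF assms(1) f_hom] by blast
  qed (use hom_in_carrier[OF f_hom] hom_in_carrier[OF g_hom] in
      \<open>auto simp: extensional_hom_def gf fg intro!: extensionalityI[of _ "carrier G"] extensionalityI[of _ "carrier H"]\<close>)
  then show ?thesis by (rule bij_betw_same_card)
qed

text \<open>As \<open>A\<close> is commutative, a family of homomorphisms on the factors multiplies
  to one on the product; restriction along the coordinate embeddings \<open>emb\<close> is the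
  inverse.\<close>

lemma card_extensional_hom_product_group:
  fixes G :: "'i \<Rightarrow> ('x, 'r) monoid_scheme" and A :: "('y, 's) monoid_scheme"
  assumes I: "finite I" and G: "\<And>i. i \<in> I \<Longrightarrow> group (G i)" and A: "comm_group A"
  shows "card (extensional_hom (product_group I G) A) = (\<Prod>i\<in>I. card (extensional_hom (G i) A))"
proof -
  interpret A: comm_group A by fact
  let ?P = "product_group I G"
  have P: "group ?P" using G by simp
  have one: "\<one>\<^bsub>G i\<^esub> \<in> carrier (G i)" if "i \<in> I" for i
    using G[OF that] by (simp add: group.is_monoid)
  define part where "part F x = (\<lambda>i\<in>I. if i \<in> F then x i else \<one>\<^bsub>G i\<^esub>)" for F x
  define emb where "emb i y = (\<lambda>j\<in>I. if j = i then y else \<one>\<^bsub>G j\<^esub>)" for i y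
  define fwd where "fwd \<phi> = (\<lambda>x\<in>carrier ?P. finprod A (\<lambda>i. \<phi> i (x i)) I)" for \<phi>
  define bwd where "bwd \<chi> = (\<lambda>i\<in>I. \<lambda>y\<in>carrier (G i). \<chi> (emb i y))" for \<chi> :: "('i \<Rightarrow> 'x) \<Rightarrow> 'y"
  have emb: "emb i y \<in> carrier ?P" if "i \<in> I" "y \<in> carrier (G i)" for i y
    using that one by (auto simp: emb_def)
  have "bij_betw fwd (PiE I (\<lambda>i. extensional_hom (G i) A)) (extensional_hom ?P A)"
  proof (rule bij_betwI[of _ _ _ bwd])
    show "fwd \<in> (\<Pi>\<^sub>E i\<in>I. extensional_hom (G i) A) \<rightarrow> extensional_hom ?P A"
    proof
      fix \<phi> assume "\<phi> \<in> (\<Pi>\<^sub>E i\<in>I. extensional_hom (G i) A)"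
      then have \<phi>: "\<phi> i \<in> hom (G i) A" if "i \<in> I" for i
        using that by (auto simp: extensional_hom_def)
      have "(\<lambda>x. finprod A (\<lambda>i. \<phi> i (x i)) I) \<in> hom ?P A"
      proof (rule homI)
        fix x y assume xy: "x \<in> carrier ?P" "y \<in> carrier ?P"
        have mem: "\<phi> i (z i) \<in> carrier A" if "i \<in> I" "z \<in> carrier ?P" for i z
          using that hom_in_carrier[OF \<phi>] by auto
        then show "finprod A (\<lambda>i. \<phi> i (x i)) I \<in> carrier A"
          using xy by (intro A.finprod_closed) auto
        have "finprod A (\<lambda>i. \<phi> i ((x \<otimes>\<^bsub>?P\<^esub> y) i)) I = finprod A (\<lambda>i. \<phi> i (x i) \<otimes>\<^bsub>A\<^esub> \<phi> i (y i)) I"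
          using xy mem by (intro A.finprod_cong') (auto intro!: hom_mult[OF \<phi>])
        also have "\<dots> = finprod A (\<lambda>i. \<phi> i (x i)) I \<otimes>\<^bsub>A\<^esub> finprod A (\<lambda>i. \<phi> i (y i)) I"
          using xy mem by (intro A.finprod_multf) auto
        finally show "finprod A (\<lambda>i. \<phi> i ((x \<otimes>\<^bsub>?P\<^esub> y) i)) I =
            finprod A (\<lambda>i. \<phi> i (x i)) I \<otimes>\<^bsub>A\<^esub> finprod A (\<lambda>i. \<phi> i (y i)) I" .
      qed
      then show "fwd \<phi> \<in> extensional_hom ?P A"
        unfolding fwd_def extensional_hom_def using restrict_in_hom[OF P] by blast
    qed
    show "bwd \<in> extensional_hom ?P A \<rightarrow> (\<Pi>\<^sub>E i\<in>I. extensional_hom (G i) A)"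
    proof
      fix \<chi> assume "\<chi> \<in> extensional_hom ?P A"
      then have \<chi>: "\<chi> \<in> hom ?P A" by (simp add: extensional_hom_def)
      have "(\<lambda>y. \<chi> (emb i y)) \<in> hom (G i) A" if i: "i \<in> I" for i
      proof (rule homI)
        fix x y assume xy: "x \<in> carrier (G i)" "y \<in> carrier (G i)"
        show "\<chi> (emb i x) \<in> carrier A" using hom_in_carrier[OF \<chi> emb[OF i xy(1)]] .
        have "emb i (x \<otimes>\<^bsub>G i\<^esub> y) = emb i x \<otimes>\<^bsub>?P\<^esub> emb i y"
          using G by (auto simp: emb_def group.is_monoid fun_eq_iff)
        then show "\<chi> (emb i (x \<otimes>\<^bsub>G i\<^esub> y)) = \<chi> (emb i x) \<otimes>\<^bsub>A\<^esub> \<chi> (emb i y)"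
          using hom_mult[OF \<chi> emb[OF i xy(1)] emb[OF i xy(2)]] by simp
      qed
      then show "bwd \<chi> \<in> (\<Pi>\<^sub>E i\<in>I. extensional_hom (G i) A)"
        unfolding bwd_def extensional_hom_def using restrict_in_hom[OF G] by auto
    qed
    show "bwd (fwd \<phi>) = \<phi>" if "\<phi> \<in> (\<Pi>\<^sub>E i\<in>I. extensional_hom (G i) A)" for \<phi>
    proof (rule extensionalityI[of _ I])
      fix i assume i: "i \<in> I"
      have \<phi>: "\<phi> j \<in> hom (G j) A" "\<phi> j \<in> extensional (carrier (G j))" if "j \<in> I" for j
        using that \<open>\<phi> \<in> _\<close> by (auto simp: extensional_hom_def)
      show "bwd (fwd \<phi>) i = \<phi> i"
      proof (rule extensionalityI[of _ "carrier (G i)"])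
        fix y assume y: "y \<in> carrier (G i)"
        \<comment> \<open>Away from the index \<open>i\<close> the coordinates of
          \<open>emb i y\<close> are identities, so only one factor survives.\<close>
        have "finprod A (\<lambda>j. \<phi> j (emb i y j)) I = finprod A (\<lambda>j. if i = j then \<phi> j y else \<one>\<^bsub>A\<^esub>) I"
          using \<phi> i y G hom_one[OF \<phi>(1) G A.is_group] hom_in_carrier[OF \<phi>(1)]
          by (intro A.finprod_cong') (auto simp: emb_def)
        also have "\<dots> = \<phi> i y"
          using i I y hom_in_carrier[OF \<phi>(1)[OF i]]
            A.finprod_singleton[of i I "\<lambda>j. if j = i then \<phi> i y else \<one>\<^bsub>A\<^esub>"]
          by (simp add: eq_commute[of i] cong: if_cong)
        finally show "bwd (fwd \<phi>) i y = \<phi> i y"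
          using i y emb[OF i y] by (simp add: bwd_def fwd_def)
      qed (use i \<phi> in \<open>auto simp: bwd_def\<close>)
    qed (use that in \<open>auto simp: bwd_def PiE_def\<close>)
    show "fwd (bwd \<chi>) = \<chi>" if "\<chi> \<in> extensional_hom ?P A" for \<chi>
    proof (rule extensionalityI[of _ "carrier ?P"])
      have \<chi>: "\<chi> \<in> hom ?P A" using that by (simp add: extensional_hom_def)
      fix x assume x: "x \<in> carrier ?P"
      then have xi: "x i \<in> carrier (G i)" if "i \<in> I" for i using that by auto
      have mem: "\<chi> (emb i (x i)) \<in> carrier A" if "i \<in> I" for i
        using hom_in_carrier[OF \<chi> emb[OF that xi[OF that]]] .
      \<comment> \<open>Induction on \<open>F\<close> assembles \<open>x\<close> from its embedded
        coordinates; at \<open>F = I\<close> the truncation \<open>part F x\<close> is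
        \<open>x\<close> itself.\<close>
      have "\<chi> (part F x) = finprod A (\<lambda>i. \<chi> (emb i (x i))) F" if "F \<subseteq> I" for F
        using finite_subset[OF that I] that
      proof (induction F)
        case empty
        have "part {} x = \<one>\<^bsub>?P\<^esub>" by (simp add: part_def)
        then show ?case using hom_one[OF \<chi> P A.is_group] by (simp only: A.finprod_empty)
      next
        case (insert i F)
        have i: "i \<in> I" "F \<subseteq> I" using insert.prems by auto
        have F: "part F x \<in> carrier ?P" using xi one by (simp add: part_def)
        have "part (insert i F) x = emb i (x i) \<otimes>\<^bsub>?P\<^esub> part F x"
        proof (rule extensionalityI[of _ I])
          fix l assume l: "l \<in> I"
          interpret Gl: group "G l" using G[OF l] .
          show "part (insert i F) x l = (emb i (x i) \<otimes>\<^bsub>?P\<^esub> part F x) l"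
            using l xi[OF l] insert.hyps by (cases "i = l") (simp_all add: part_def emb_def)
        qed (simp_all add: part_def)
        then have "\<chi> (part (insert i F) x) = \<chi> (emb i (x i)) \<otimes>\<^bsub>A\<^esub> \<chi> (part F x)"
          using hom_mult[OF \<chi> emb[OF i(1) xi[OF i(1)]] F] by (simp only:)
        also have "\<dots> = \<chi> (emb i (x i)) \<otimes>\<^bsub>A\<^esub> finprod A (\<lambda>i. \<chi> (emb i (x i))) F"
          using insert.IH[OF i(2)] by (simp only:)
        also have "\<dots> = finprod A (\<lambda>i. \<chi> (emb i (x i))) (insert i F)"
          by (rule A.finprod_insert[symmetric]) (use insert.hyps i mem in auto)
        finally show ?case .
      qed
      from this[of I] have "\<chi> (part I x) = finprod A (\<lambda>i. \<chi> (emb i (x i))) I" by simp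
      moreover have "part I x = x"
        using x by (intro extensionalityI[of _ I]) (auto simp: part_def PiE_def)
      moreover have "finprod A (\<lambda>i. bwd \<chi> i (x i)) I = finprod A (\<lambda>i. \<chi> (emb i (x i))) I"
        using mem xi by (intro A.finprod_cong') (auto simp: bwd_def)
      ultimately show "fwd (bwd \<chi>) x = \<chi> x"
        using x by (simp add: fwd_def)
    qed (use that in \<open>auto simp: fwd_def extensional_hom_def\<close>)
  qed
  then have "card (extensional_hom ?P A) = card (PiE I (\<lambda>i. extensional_hom (G i) A))"
    using bij_betw_same_card by metis
  then show ?thesis using I by (simp add: card_PiE)
qed

text \<open>A homomorphism is determined by the image \<open>y\<close> of 1, and the only relation
  to respect is that \<open>N * y\<close> is zero modulo \<open>M\<close>. With \<open>N > 1\<close>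
  the integer 1 is itself a representative in the carrier.\<close>

lemma card_extensional_hom_integer_mod_group:
  assumes N: "N > 1" and M: "M > 0"
  shows "card (extensional_hom (integer_mod_group N) (integer_mod_group M)) =
    card {y \<in> {0..<int M}. int M dvd int N * y}"
proof -
  let ?Z = "integer_mod_group N" and ?Y = "integer_mod_group M"
  have Z: "carrier ?Z = {0..<int N}" and Y: "carrier ?Y = {0..<int M}"
    using N M by (auto simp: carrier_integer_mod_group)
  interpret finite_comm_group ?Z
    by (intro finite_comm_group.intro abelian_integer_mod_group finite_comm_group_axioms.intro) (simp add: Z)
  let ?g = "\<lambda>y. \<lambda>x\<in>carrier ?Z. (x * y) mod int M"
  have one: "1 \<in> carrier ?Z" using N by (simp add: Z)
  have pow: "\<chi> (int n mod int N) = (int n * \<chi> 1) mod int M" if "\<chi> \<in> hom ?Z ?Y" for \<chi> n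
    using hom_integer_mod_group_pow[OF that M one, of n] by (simp add: one)
  have "bij_betw (\<lambda>\<chi>. \<chi> 1) (extensional_hom ?Z ?Y) {y \<in> {0..<int M}. int M dvd int N * y}"
  proof (rule bij_betwI[of _ _ _ ?g])
    show "(\<lambda>\<chi>. \<chi> 1) \<in> extensional_hom ?Z ?Y \<rightarrow> {y \<in> {0..<int M}. int M dvd int N * y}"
    proof
      fix \<chi> assume "\<chi> \<in> extensional_hom ?Z ?Y"
      then have \<chi>: "\<chi> \<in> hom ?Z ?Y" by (simp add: extensional_hom_def)
      have "int M dvd int N * \<chi> 1"
        using pow[OF \<chi>, of N] hom_integer_mod_group_one[OF \<chi>] by auto
      then show "\<chi> 1 \<in> {y \<in> {0..<int M}. int M dvd int N * y}"
        using hom_in_carrier[OF \<chi> one] by (simp add: Y)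
    qed
    show "?g \<in> {y \<in> {0..<int M}. int M dvd int N * y} \<rightarrow> extensional_hom ?Z ?Y"
    proof
      fix y assume y: "y \<in> {y \<in> {0..<int M}. int M dvd int N * y}"
      have "(\<lambda>x. (x * y) mod int M) \<in> hom ?Z ?Y"
      proof (rule homI)
        fix a b
        show "(a * y) mod int M \<in> carrier ?Y" using M by (simp add: Y)
        \<comment> \<open>Reducing \<open>a + b\<close> modulo \<open>N\<close> changes the product
          with \<open>y\<close> by a multiple of \<open>N * y\<close>, which is zero modulo
          \<open>M\<close>.\<close>
        have "int M dvd int N * y * ((a + b) div int N)" using y by simp
        moreover have "(a + b) * y - ((a + b) mod int N) * y = int N * y * ((a + b) div int N)"
          by (subst div_mult_mod_eq[of "a + b" "int N", symmetric], unfold distrib_right) simp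
        ultimately have "((a + b) * y) mod int M = (((a + b) mod int N) * y) mod int M"
          by (simp add: mod_eq_dvd_iff)
        then show "((a \<otimes>\<^bsub>?Z\<^esub> b) * y) mod int M = (a * y) mod int M \<otimes>\<^bsub>?Y\<^esub> ((b * y) mod int M)"
          by (simp add: mod_add_eq distrib_right)
      qed
      then show "?g y \<in> extensional_hom ?Z ?Y"
        by (simp add: extensional_hom_def restrict_in_hom)
    qed
    show "?g (\<chi> 1) = \<chi>" if "\<chi> \<in> extensional_hom ?Z ?Y" for \<chi>
    proof (rule extensionalityI[of _ "carrier ?Z"])
      fix x assume x: "x \<in> carrier ?Z"
      have "\<chi> \<in> hom ?Z ?Y" using that by (simp add: extensional_hom_def)
      from pow[OF this, of "nat x"] show "?g (\<chi> 1) x = \<chi> x" using x by (simp add: Z)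
    qed (use that in \<open>auto simp: extensional_hom_def\<close>)
    show "?g y 1 = y" if "y \<in> {y \<in> {0..<int M}. int M dvd int N * y}" for y
      using that one by simp
  qed
  then show ?thesis by (rule bij_betw_same_card)
qed

text \<open>For \<open>k \<le> s\<close> every residue is an admissible image of 1; otherwise the
  admissible ones are the \<open>p ^ s\<close> multiples of \<open>p ^ (k - s)\<close>.\<close>

lemma card_extensional_hom_prime_power:
  assumes p: "prime p" and s: "s \<ge> 1"
  shows "card (extensional_hom (integer_mod_group (p ^ s)) (integer_mod_group (p ^ k))) = p ^ min s k"
proof -
  have p1: "p > 1" using p prime_gt_1_nat by blast
  have N: "p ^ s > 1" and M: "p ^ k > 0" using p1 one_less_power[OF p1, of s] s by auto
  have "card {y \<in> {0..<int (p ^ k)}. int (p ^ k) dvd int (p ^ s) * y} = p ^ min s k"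
  proof (cases "k \<le> s")
    case True
    then have "int (p ^ k) dvd int (p ^ s) * y" for y
      by (simp add: le_imp_power_dvd)
    then have "{y \<in> {0..<int (p ^ k)}. int (p ^ k) dvd int (p ^ s) * y} = {0..<int (p ^ k)}"
      by blast
    then show ?thesis using True by (simp only: card_atLeastLessThan_int diff_0_right nat_int min_absorb2)
  next
    case False
    then have k: "p ^ k = p ^ (k - s) * p ^ s" by (simp flip: power_add)
    have "int (p ^ k) dvd int (p ^ s) * y \<longleftrightarrow> int (p ^ (k - s)) dvd y" for y
      using p1 unfolding k by (simp add: mult.commute)
    then have "{y \<in> {0..<int (p ^ k)}. int (p ^ k) dvd int (p ^ s) * y} =
        {y \<in> {0..<int (p ^ (k - s) * p ^ s)}. int (p ^ (k - s)) dvd y}"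
      using k by simp
    then show ?thesis
      using card_multiples[of "p ^ (k - s)" "p ^ s"] p1 False by simp
  qed
  then show ?thesis using card_extensional_hom_integer_mod_group[OF N M] by simp
qed

lemma card_extensional_hom_abelian_p_group:
  assumes p: "prime p"
  shows "card (extensional_hom (abelian_p_group p n a) (integer_mod_group (p ^ k))) =
    p ^ (\<Sum>s=1..n. min s k * a s)"
proof -
  have "card (extensional_hom (abelian_p_group p n a) (integer_mod_group (p ^ k))) =
      (\<Prod>s=1..n. \<Prod>j<a s. card (extensional_hom (integer_mod_group (p ^ s)) (integer_mod_group (p ^ k))))"
    by (simp add: abelian_p_group_def card_extensional_hom_product_group)
  also have "\<dots> = (\<Prod>s=1..n. p ^ (min s k * a s))"
    by (intro prod.cong) (simp_all add: card_extensional_hom_prime_power[OF p] power_mult)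
  also have "\<dots> = p ^ (\<Sum>s=1..n. min s k * a s)" by (simp add: power_sum)
  finally show ?thesis .
qed

lemma finite_abelian_p_group: "prime p \<Longrightarrow> finite (carrier (abelian_p_group p n a))"
  by (auto simp: abelian_p_group_def carrier_integer_mod_group intro!: finite_PiE)

lemma group_abelian_p_group: "group (abelian_p_group p n a)"
  by (simp add: abelian_p_group_def)

section \<open>Evaluation of the exponents and the coefficient formula\<close>

text \<open>The hypotheses allow exactly \<open>k = r\<close> and \<open>k = r - 1\<close>. In both
  cases \<open>min s k\<close> is \<open>s\<close> for \<open>s < r\<close> and \<open>k\<close>
  from \<open>r\<close> on.\<close>

lemma sum_min_mult_eq:
  assumes "1 \<le> r" "r \<le> n" "r \<le> Suc k" "k \<le> r"
  shows "(\<Sum>s=1..n. min s k * a s) = c_exp a r + k * b_exp n a r"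
proof -
  have "{1..n} = {1..<r} \<union> {r..n}" using assms by auto
  then have "(\<Sum>s=1..n. min s k * a s) = (\<Sum>s\<in>{1..<r} \<union> {r..n}. min s k * a s)"
    by (rule sum.cong) simp
  also have "\<dots> = (\<Sum>s=1..<r. min s k * a s) + (\<Sum>s=r..n. min s k * a s)"
    by (rule sum.union_disjoint) auto
  also have "(\<Sum>s=1..<r. min s k * a s) = c_exp a r"
    unfolding c_exp_def using assms by (intro sum.cong) auto
  also have "(\<Sum>s=r..n. min s k * a s) = k * b_exp n a r"
    unfolding b_exp_def sum_distrib_left using assms by (intro sum.cong) auto
  finally show ?thesis .
qed

text \<open>The two pure powers of \<open>p\<close> are the numbers of characters with values modulo
  \<open>p ^ r\<close> and modulo \<open>p ^ (r - 1)\<close>. The additive form avoids division in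
  the natural numbers.\<close>

lemma wedderburn_coeff_abelian_p_group:
  fixes G :: "('g, 'm) monoid_scheme"
  assumes p: "prime p" and G: "comm_group G" "G \<cong> abelian_p_group p n a" and r: "1 \<le> r" "r \<le> n"
  shows "p ^ (c_exp a r + r * b_exp n a r) =
    p ^ (c_exp a r + (r - 1) * b_exp n a r) + (p ^ r - p ^ (r - 1)) * wedderburn_coeff G (p ^ r)"
proof -
  interpret comm_group G by fact
  obtain f where "bij_betw f (carrier G) (carrier (abelian_p_group p n a))"
    using G(2) by (auto simp: is_iso_def iso_def)
  then have "finite (carrier G)"
    using finite_abelian_p_group[OF p] bij_betw_finite by blast
  then interpret finite_comm_group G by unfold_locales
  have hom: "card (extensional_hom G (integer_mod_group (p ^ k))) = p ^ (\<Sum>s=1..n. min s k * a s)" for k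
    using card_extensional_hom_iso[OF is_group _ G(2)] group_abelian_p_group card_extensional_hom_abelian_p_group[OF p] by metis
  have "Suc (r - 1) = r" using r by simp
  moreover have "(\<Sum>s=1..n. min s k * a s) = c_exp a r + k * b_exp n a r" if "k = r \<or> k = r - 1" for k
    using that r by (intro sum_min_mult_eq) auto
  ultimately show ?thesis
    using card_extensional_hom_diff[OF p, of "r - 1", unfolded hom] by simp
qed

theorem theorem6p2:
  fixes n r :: nat and a :: "nat \<Rightarrow> nat"
  assumes "n \<ge> 1" and "a n \<ge> 1" and "1 \<le> r" and "r \<le> n"
  shows "\<exists>P :: int poly. \<forall>p::nat. prime p \<longrightarrow>
    of_int (poly P (int p)) =
      of_nat p ^ (c_exp a r + (r - 1) * (b_exp n a r - 1)) *
      ((of_nat p ^ b_exp n a r - 1) / (of_nat p - 1) :: rat) \<and>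
    (\<forall>G :: ('g, 'm) monoid_scheme. comm_group G \<and> G \<cong> abelian_p_group p n a \<longrightarrow>
       int (wedderburn_coeff G (p ^ r)) = poly P (int p))"
proof -
  let ?b = "b_exp n a r" and ?c = "c_exp a r"
  \<comment> \<open>The geometric sum replaces the quotient by \<open>p - 1\<close>, so one integer
    polynomial serves all primes.\<close>
  let ?P = "monom 1 (?c + (r - 1) * (?b - 1)) * (\<Sum>i<?b. monom 1 i) :: int poly"
  have poly: "poly ?P x = x ^ (?c + (r - 1) * (?b - 1)) * (\<Sum>i<?b. x ^ i)" for x
    by (simp add: poly_monom poly_sum)
  \<comment> \<open>The exponent \<open>?b\<close> is positive because \<open>a n \<ge> 1\<close>,
    so the truncated subtraction \<open>?b - 1\<close> is a true one.\<close>
  have "a n \<le> ?b"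
    unfolding b_exp_def using assms by (intro member_le_sum) auto
  then have b: "?b = Suc (?b - 1)" using assms by simp
  show ?thesis
  proof (intro exI[of _ ?P] allI impI conjI)
    fix p :: nat assume p: "prime p"
    then have p1: "p > 1" using prime_gt_1_nat by blast
    have geo: "(int p - 1) * (\<Sum>i<?b. int p ^ i) = int p ^ ?b - 1"
      by (simp add: power_diff_1_eq)
    then have "of_int ((int p - 1) * (\<Sum>i<?b. int p ^ i)) = (of_int (int p ^ ?b - 1) :: rat)"
      by simp
    then have "of_int (\<Sum>i<?b. int p ^ i) = ((of_nat p ^ ?b - 1) / (of_nat p - 1) :: rat)"
      using p1 by (simp add: field_simps)
    then show "of_int (poly ?P (int p)) = of_nat p ^ (?c + (r - 1) * (?b - 1)) *
        ((of_nat p ^ ?b - 1) / (of_nat p - 1) :: rat)"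
      by (simp only: poly of_int_mult of_int_power of_int_of_nat_eq)
    fix G :: "('g, 'm) monoid_scheme"
    assume G: "comm_group G \<and> G \<cong> abelian_p_group p n a"
    let ?W = "wedderburn_coeff G (p ^ r)"
    define e where "e = ?c + (r - 1) * (?b - 1)"
    define k where "k = int p ^ (r - 1)"
    have k: "int p ^ r = int p * k"
      using assms by (simp add: k_def flip: power_Suc)
    \<comment> \<open>Both character counts share the factor \<open>p ^ e * p ^ (r - 1)\<close>;
      splitting it off leaves 1 and \<open>p ^ ?b\<close>.\<close>
    have exps: "?c + (r - 1) * ?b = e + (r - 1)" "?c + r * ?b = e + (r - 1) + ?b"
    proof -
      obtain r' b' where "r = Suc r'" "?b = Suc b'" using assms b by (metis Suc_pred' zero_less_Suc less_eq_Suc_le One_nat_def)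
      then show "?c + (r - 1) * ?b = e + (r - 1)" "?c + r * ?b = e + (r - 1) + ?b"
        by (simp_all add: e_def)
    qed
    have "p ^ (r - 1) \<le> p ^ r" using p1 by (intro power_increasing) auto
    then have "int p ^ (?c + r * ?b) = int p ^ (?c + (r - 1) * ?b) + (int p ^ r - int p ^ (r - 1)) * int ?W"
      using arg_cong[OF wedderburn_coeff_abelian_p_group[OF p, of G n a r], of int] G assms
      by (simp add: of_nat_diff)
    then have "int p ^ e * k * int p ^ ?b = int p ^ e * k + (int p * k - k) * int ?W"
      by (simp only: exps power_add k) (simp only: k_def)
    then have "(k * (int p - 1)) * int ?W = (k * int p ^ e) * (int p ^ ?b - 1)"
      by (simp add: algebra_simps)
    also have "\<dots> = (k * (int p - 1)) * poly ?P (int p)"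
      unfolding poly geo[symmetric] e_def by (simp only: mult_ac)
    \<comment> \<open>The factor \<open>k * (p - 1)\<close> is nonzero and cancels.\<close>
    finally show "int ?W = poly ?P (int p)"
      using p1 by (simp add: k_def)
  qed
qed

end
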